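(* Let $p=c_n/n$ where $2\le c_n\le \log^2 n$, and let $P=P_{\mathcal{B}(n,n,p)}$. Then (a) asymptotically almost surely $\dim P\ge (1-o(1))\frac{1}{2\alpha_{c_n}}$; (b) there exist absolute constants $\gamma_1,\gamma_2>0$, independent of $n$ and $c_n$, such that asymptotically almost surely $\gamma_1 c_n/\log c_n\le \dim P\le \gamma_2 c_n\log^2 c_n$.
   Context: For $c>0$, $\alpha_c$ denotes the unique positive solution $x$ of $\frac{e^2}{x^2}e^{-cx}=1$. $\mathcal{B}(n,n,p)$ is the random bipartite graph with parts $A=[n]$ and $B=\{n+1,\dots,2n\}$ in which each pair $ij$, $i\in A$, $j\in B$, is an edge independently with probability $p$; $P_{\mathcal{B}(n,n,p)}$ is the poset on $A\cup B$ with $i<_P j$ iff $i\in A$, $j\in B$ and $ij$ is an edge. The dimension of a poset is the minimum number of linear orders whose intersection is its order. Asymptotically almost surely means with probability tending to 1 as $n\to\infty$; $o(1)$ is as $n\to\infty$. *)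

theory Defs
  imports "HOL-Probability.Probability"
begin

definition alpha :: "real \<Rightarrow> real" where
  "alpha c = (THE x. 0 < x \<and> exp 2 / x ^ 2 * exp (- (c * x)) = 1)"

lemma alpha_ex1:
  assumes "0 < c"
  shows "\<exists>!x::real. 0 < x \<and> exp 2 / x ^ 2 * exp (- (c * x)) = 1"
proof -
  define g where "g = (\<lambda>x::real. 2 * ln x + c * x)"
  have iff: "0 < x \<and> exp 2 / x ^ 2 * exp (- (c * x)) = 1 \<longleftrightarrow> 0 < x \<and> g x = 2" for x :: real
  proof (cases "0 < x")
    case True
    have "x ^ 2 = exp (2 * ln x)"
      using True by (simp add: exp_double)
    then have "exp 2 / x ^ 2 * exp (- (c * x)) = exp (2 - g x)"
      by (simp add: g_def exp_diff exp_minus exp_add field_simps)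
    then show ?thesis using True by auto
  qed simp
  have mono: "g x < g y" if "0 < x" "x < y" for x y
    using that assms by (simp add: g_def add_strict_mono)
  define a where "a = exp (- c)"
  define b where "b = 1 + 2 / c"
  have a: "0 < a" "a < 1" using assms by (auto simp: a_def)
  have b: "1 < b" using assms by (simp add: b_def)
  have "c * a < c" using a assms by simp
  moreover have "ln a = - c" by (simp add: a_def)
  ultimately have "g a \<le> 2" using assms unfolding g_def by linarith
  moreover have "2 \<le> g b"
  proof -
    have "2 \<le> c * b" using assms by (simp add: b_def field_simps)
    moreover have "0 \<le> ln b" using b by simp
    ultimately show ?thesis unfolding g_def by linarith
  qed
  moreover have "continuous_on {a..b} g"
    unfolding g_def using a by (auto intro!: continuous_intros)
  ultimately obtain x where "a \<le> x" "g x = 2"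
    using IVT'[of g a 2 b] a b by auto
  then have "0 < x \<and> g x = 2" using a by simp
  moreover have "y = x" if "0 < y \<and> g y = 2" for y
    using mono[of x y] mono[of y x] that \<open>0 < x \<and> g x = 2\<close> by (metis less_irrefl linorder_neqE)
  ultimately show ?thesis unfolding iff by blast
qed

text \<open>Orders are reflexive, as in \<^const>\<open>linear_order_on\<close>.\<close>

definition poset_dim :: "'a set \<Rightarrow> 'a rel \<Rightarrow> nat" where
  "poset_dim V r =
     (LEAST d. \<exists>L. finite L \<and> card L = d \<and> (\<forall>l\<in>L. linear_order_on V l) \<and> \<Inter>L = r)"

text \<open>A bipartite graph is given by its set of edges, the edge joining \<open>i\<close> in \<open>A\<close> to \<open>j\<close> in \<open>B\<close>
  being the pair \<open>(i, j)\<close>.\<close>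

definition random_bipartite :: "nat \<Rightarrow> real \<Rightarrow> (nat \<times> nat) set pmf" where
  "random_bipartite n p =
     map_pmf (\<lambda>f. {e. f e}) (Pi_pmf ({1..n} \<times> {n+1..2*n}) False (\<lambda>_. bernoulli_pmf p))"

definition bipartite_order :: "nat \<Rightarrow> (nat \<times> nat) set \<Rightarrow> nat rel" where
  "bipartite_order n E =
     Id_on {1..2*n} \<union> {(i, j). i \<in> {1..n} \<and> j \<in> {n+1..2*n} \<and> (i, j) \<in> E}"

definition bipartite_dim :: "nat \<Rightarrow> (nat \<times> nat) set \<Rightarrow> nat" where
  "bipartite_dim n E = poset_dim {1..2*n} (bipartite_order n E)"

definition aas :: "(nat \<Rightarrow> 'a pmf) \<Rightarrow> (nat \<Rightarrow> 'a \<Rightarrow> bool) \<Rightarrow> bool" where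
  "aas M Q \<longleftrightarrow> (\<lambda>n. measure_pmf.prob (M n) {x. Q n x}) \<longlonglongrightarrow> 1"

text \<open>The bounds are required only for large \<open>n\<close>: for \<open>1 \<le> n \<le> 4\<close> no real number lies between
  \<open>2\<close> and \<open>(ln n)\<^sup>2\<close>.\<close>

definition admissible :: "(nat \<Rightarrow> real) \<Rightarrow> bool" where
  "admissible c \<longleftrightarrow> (\<forall>\<^sub>F n in sequentially. 2 \<le> c n \<and> c n \<le> (ln (real n)) ^ 2)"

end

theory Submission
  imports Defs "HOL-Real_Asymp.Real_Asymp"
begin

text \<open>
  A linear extension that puts \<open>b\<close> below \<open>a\<close> for a set of pairs \<open>(a, b)\<close> avoids all edges on that
  set, and the sets \<open>{b. b < a}\<close> form a chain. If the graph has no empty \<open>k\<close> by \<open>k\<close>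
  rectangle, such a set has at most \<open>2 k n\<close> elements, while a realizer has to cover all
  \<open>n\<^sup>2 - O(c n)\<close> non-edges. The first moment threshold for empty rectangles is
  \<open>k = alpha c * n\<close>, which gives the lower bound \<open>1 / (2 alpha c)\<close>; and
  \<open>alpha c \<le> 4 ln c / c\<close>.

  For the upper bound, cut \<open>B\<close> into about \<open>c / ln c\<close> blocks, so that most left vertices have
  \<open>O(ln c)\<close> neighbours in every block. Because small vertex sets span few edges, the graph joining
  two vertices of a block with a common low-degree neighbour is degenerate and has a proper colouring
  with polynomially many colours in \<open>c\<close>; a random family of \<open>O((ln c)\<^sup>3)\<close> subsets of the colours
  then yields orders that reverse all non-edges between the block and the low-degree vertices. The
  exceptional left vertices are so few that the graph between them and \<open>B\<close> is 2-degenerate and has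
  colourings with boundedly many colours in which any two colour classes induce a star forest; a
  bounded number of orders reverses its non-edges. Degeneracy replaces the local lemma, so vertices
  of unbounded degree do no harm.
\<close>

section \<open>Covering non-edges by reversible sets\<close>

text \<open>The bounds must be uniform from bounded \<open>c\<close> up to \<open>(ln n)^2\<close>.
  For bounded \<open>c\<close> the maximum degree still tends to infinity while the number of blocks
  stays bounded, so vertices of high degree in some block are unavoidable and must cost a number of
  orders independent of \<open>n\<close> and \<open>c\<close>; this forces two separate covering
  arguments. The block length \<open>n * ln c / c\<close> balances the cost of the first: separating
  a colour from \<open>r\<close> others takes of the order of \<open>r^2 * ln c\<close> sets,
  \<open>r\<close> is of order \<open>ln c\<close>, the expected degree into a block, and
  \<open>(c / ln c) * (ln c)^3 = c * (ln c)^2\<close>. Both arguments live on one scale,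
  \<open>n / (4 * c^4)\<close>. For sizes \<open>s\<close> below it, the expected number of overly
  dense sets is at most \<open>(2 * c^4 * s / n)^s\<close>; these terms sum to
  \<open>O(c^4 / n)\<close>, which vanishes because \<open>c\<close> is polylogarithmic in
  \<open>n\<close>. The constant 48 in the degree bound pushes the exceptional vertices below the
  same scale. Larger sets need no randomness: they have at least \<open>n / (8 * c^4)\<close>
  elements, so the trivial bound \<open>n\<close> is already linear in their size, and only the
  number of colours pays for it.\<close>

definition reversible :: "('a \<times> 'b) set \<Rightarrow> ('a \<times> 'b) set \<Rightarrow> bool" where
  "reversible E T \<longleftrightarrow>
     (\<exists>(f :: 'a \<Rightarrow> int) g. (\<forall>(a, b)\<in>E. f a < g b) \<and> (\<forall>(a, b)\<in>T. g b < f a))"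

definition coverable :: "('a \<times> 'b) set \<Rightarrow> ('a \<times> 'b) set \<Rightarrow> nat \<Rightarrow> bool" where
  "coverable E P k \<longleftrightarrow>
     (\<exists>\<T>. finite \<T> \<and> card \<T> \<le> k \<and> P \<subseteq> \<Union>\<T> \<and> (\<forall>T\<in>\<T>. reversible E T))"

lemma coverable_mono: "coverable E P k \<Longrightarrow> Q \<subseteq> P \<Longrightarrow> k \<le> l \<Longrightarrow> coverable E Q l"
  unfolding coverable_def by (meson order_trans)

lemma coverable_Un:
  assumes "coverable E P k" "coverable E Q l"
  shows "coverable E (P \<union> Q) (k + l)"
proof -
  obtain S where S: "finite S" "card S \<le> k" "P \<subseteq> \<Union>S" "\<forall>T\<in>S. reversible E T"
    using assms(1) unfolding coverable_def by blast
  obtain T where T: "finite T" "card T \<le> l" "Q \<subseteq> \<Union>T" "\<forall>U\<in>T. reversible E U"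
    using assms(2) unfolding coverable_def by blast
  have "card (S \<union> T) \<le> k + l" using card_Un_le[of S T] S T by linarith
  then show ?thesis unfolding coverable_def using S T by (intro exI[of _ "S \<union> T"]) auto
qed

lemma coverable_UN:
  assumes "finite I" "\<And>i. i \<in> I \<Longrightarrow> coverable E (P i) k"
  shows "coverable E (\<Union>i\<in>I. P i) (card I * k)"
  using assms
proof (induction I rule: finite_induct)
  case empty
  then show ?case unfolding coverable_def by (intro exI[of _ "{}"]) auto
next
  case (insert i I)
  then have "coverable E (P i \<union> (\<Union>i\<in>I. P i)) (k + card I * k)"
    by (intro coverable_Un) auto
  then show ?case using insert by simp
qed

text \<open>Negating the heights turns the order upside down, which exchanges the roles of the two
  sides.\<close>

lemma reversible_converse: "reversible E T \<Longrightarrow> reversible (E\<inverse>) (T\<inverse>)"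
  unfolding reversible_def
proof (elim exE conjE)
  fix f :: "'a \<Rightarrow> int" and g :: "'b \<Rightarrow> int"
  assume "\<forall>(a, b)\<in>E. f a < g b" "\<forall>(a, b)\<in>T. g b < f a"
  then show "\<exists>(f :: 'b \<Rightarrow> int) g. (\<forall>(a, b)\<in>E\<inverse>. f a < g b) \<and> (\<forall>(a, b)\<in>T\<inverse>. g b < f a)"
    by (intro exI[of _ "\<lambda>x. - g x"] exI[of _ "\<lambda>x. - f x"]) auto
qed

lemma coverable_converse:
  assumes "coverable E P k"
  shows "coverable (E\<inverse>) (P\<inverse>) k"
proof -
  obtain S where S: "finite S" "card S \<le> k" "P \<subseteq> \<Union>S" "\<forall>T\<in>S. reversible E T"
    using assms unfolding coverable_def by blast
  have rev: "\<forall>T\<in>converse ` S. reversible (E\<inverse>) T" using S(4) by (auto intro: reversible_converse)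
  have "card (converse ` S) \<le> k" using card_image_le[OF S(1), of converse] S(2) by linarith
  moreover have "P\<inverse> \<subseteq> \<Union>(converse ` S)" using S(3) by auto
  ultimately show ?thesis unfolding coverable_def using S(1) rev
    by (intro exI[of _ "converse ` S"]) blast
qed

text \<open>Place the left vertex \<open>a\<close> directly below its first neighbour in the order of \<open>V\<close>
  given by \<open>h\<close>, and all right vertices outside \<open>V\<close> on top.\<close>

lemma reversible_order:
  fixes h :: "'b \<Rightarrow> nat"
  assumes "finite V"
  shows "reversible E {(a, b). b \<in> V \<and> (\<forall>b'\<in>V. (a, b') \<in> E \<longrightarrow> h b < h b')}"
proof -
  obtain N where N: "\<And>b. b \<in> V \<Longrightarrow> h b < N"
    using finite_nat_bounded[OF finite_imageI[OF assms, of h]] by auto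
  \<comment> \<open>Left vertices get even heights and right vertices odd ones, so \<open>a\<close>
    at twice the rank of its first neighbour lies just below it. The default \<open>N\<close> serves
    an \<open>a\<close> without neighbours in \<open>V\<close>: it then lies above all of
    \<open>V\<close> and below the outside vertices at \<open>2 * N + 1\<close>.\<close>
  define W where "W a = insert N (h ` {b\<in>V. (a, b) \<in> E})" for a
  define f where "f a = 2 * int (Min (W a))" for a
  define g where "g b = (if b \<in> V then 2 * int (h b) + 1 else 2 * int N + 1)" for b
  have fin: "finite (W a)" "W a \<noteq> {}" for a using assms by (auto simp: W_def)
  have "f a < g b" if "(a, b) \<in> E" for a b
  proof (cases "b \<in> V")
    case True
    then have "Min (W a) \<le> h b" using that fin(1)[of a] by (intro Min_le) (auto simp: W_def)
    then show ?thesis using True by (simp add: f_def g_def)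
  next
    case False
    have "Min (W a) \<le> N" using fin(1)[of a] by (intro Min_le) (auto simp: W_def)
    then show ?thesis using False by (simp add: f_def g_def)
  qed
  moreover have "g b < f a" if "b \<in> V" "\<forall>b'\<in>V. (a, b') \<in> E \<longrightarrow> h b < h b'" for a b
  proof -
    have "Min (W a) \<in> W a" using fin by (intro Min_in) auto
    then have "h b < Min (W a)" using that N[of b] by (auto simp: W_def)
    then show ?thesis using that by (simp add: f_def g_def)
  qed
  ultimately show ?thesis unfolding reversible_def by (intro exI[of _ f] exI[of _ g]) auto
qed

text \<open>Each colour set \<open>Q\<close> yields two orders of \<open>V\<close>: the vertices with colours in \<open>Q\<close> come first,
  in increasing or decreasing order. The two directions take care of the at most one neighbour of
  \<open>a\<close> that has the same colour as \<open>b\<close>.\<close>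

lemma coverable_selective:
  fixes E :: "('a \<times> 'b) set" and \<phi> :: "'b \<Rightarrow> 'c"
  assumes V: "finite V" and Q: "finite \<Q>"
    and inj: "\<And>a. a \<in> U \<Longrightarrow> inj_on \<phi> {b\<in>V. (a, b) \<in> E}"
    and sel: "\<And>a b. a \<in> U \<Longrightarrow> b \<in> V \<Longrightarrow> (a, b) \<notin> E \<Longrightarrow>
      \<exists>Q\<in>\<Q>. \<phi> b \<in> Q \<and> (\<forall>b'\<in>V. (a, b') \<in> E \<longrightarrow> \<phi> b' \<noteq> \<phi> b \<longrightarrow> \<phi> b' \<notin> Q)"
  shows "coverable E (U \<times> V - E) (2 * card \<Q>)"
proof -
  obtain h0 :: "'b \<Rightarrow> nat" and N where h0: "h0 ` V = {i. i < N}" "inj_on h0 V"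
    using finite_imp_inj_to_nat_seg[OF V] by blast
  have less: "h0 b < N" if "b \<in> V" for b using h0(1) that by blast
  \<comment> \<open>All vertices with colours outside \<open>Q\<close> share the rank
    \<open>N\<close>. These ties are harmless: \<open>h\<close> is only compared starting from a
    \<open>b\<close> with colour in \<open>Q\<close>, whose rank is below \<open>N\<close>.\<close>
  define h where "h Q d b = (if \<phi> b \<in> Q then if d then h0 b else N - 1 - h0 b else N)" for Q d b
  define R where "R Q d = {(a, b). b \<in> V \<and> (\<forall>b'\<in>V. (a, b') \<in> E \<longrightarrow> h Q d b < h Q d b')}" for Q d
  define \<T> where "\<T> = (\<lambda>Q. R Q True) ` \<Q> \<union> (\<lambda>Q. R Q False) ` \<Q>"
  have "card \<T> \<le> 2 * card \<Q>"
    unfolding \<T>_def using card_Un_le[of "(\<lambda>Q. R Q True) ` \<Q>" "(\<lambda>Q. R Q False) ` \<Q>"]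
      card_image_le[OF Q, of "\<lambda>Q. R Q True"] card_image_le[OF Q, of "\<lambda>Q. R Q False"] by linarith
  moreover have "reversible E T" if "T \<in> \<T>" for T
    using that reversible_order[OF V, of E] by (auto simp: \<T>_def R_def)
  moreover have cov: "(a, b) \<in> \<Union>\<T>" if ab: "a \<in> U" "b \<in> V" "(a, b) \<notin> E" for a b
  proof -
    obtain Q where Qb: "Q \<in> \<Q>" "\<phi> b \<in> Q"
      and out: "\<And>b'. b' \<in> V \<Longrightarrow> (a, b') \<in> E \<Longrightarrow> \<phi> b' \<noteq> \<phi> b \<Longrightarrow> \<phi> b' \<notin> Q"
      using sel[OF ab] by blast
    have uniq: "x = y" if "x \<in> V" "y \<in> V" "(a, x) \<in> E" "(a, y) \<in> E" "\<phi> x = \<phi> b" "\<phi> y = \<phi> b" for x y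
      using inj_onD[OF inj[OF ab(1)], of x y] that by simp
    define d where "d \<longleftrightarrow> (\<forall>b'\<in>V. (a, b') \<in> E \<longrightarrow> \<phi> b' = \<phi> b \<longrightarrow> h0 b < h0 b')"
    have "h Q d b < h Q d b'" if b': "b' \<in> V" "(a, b') \<in> E" for b'
    proof (cases "\<phi> b' = \<phi> b")
      case True
      then have "\<phi> b' \<in> Q" using Qb by simp
      have ne: "h0 b \<noteq> h0 b'" using h0(2) ab b' by (auto dest: inj_onD)
      show ?thesis
      proof (cases d)
        case True
        then show ?thesis using \<open>\<phi> b' = \<phi> b\<close> b' Qb unfolding d_def h_def by auto
      next
        case False
        then obtain y where y: "y \<in> V" "(a, y) \<in> E" "\<phi> y = \<phi> b" "\<not> h0 b < h0 y"
          unfolding d_def by blast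
        then have "b' = y" using uniq[of y b'] b' \<open>\<phi> b' = \<phi> b\<close> by blast
        then have "h0 b' < h0 b" using y(4) ne by simp
        then show ?thesis using False \<open>\<phi> b' \<in> Q\<close> Qb less[OF ab(2)] unfolding h_def by auto
      qed
    next
      case False
      then have "\<phi> b' \<notin> Q" using out b' by blast
      then show ?thesis using Qb less[OF ab(2)] unfolding h_def by auto
    qed
    then have "(a, b) \<in> R Q d" unfolding R_def using ab by blast
    then show ?thesis unfolding \<T>_def using Qb(1) by (cases d) auto
  qed
  moreover have "U \<times> V - E \<subseteq> \<Union>\<T>" using cov by blast
  moreover have "finite \<T>" using Q by (simp add: \<T>_def)
  ultimately show ?thesis unfolding coverable_def by blast
qed

text \<open>With at most one neighbour per left vertex a single colour suffices, and the two orders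
  are any order of \<open>V\<close> and its reverse.\<close>

lemma coverable_degree_le_1:
  assumes "finite V" "\<And>a x y. a \<in> U \<Longrightarrow> x \<in> V \<Longrightarrow> y \<in> V \<Longrightarrow> (a, x) \<in> E \<Longrightarrow> (a, y) \<in> E \<Longrightarrow> x = y"
  shows "coverable E (U \<times> V - E) 2"
proof -
  have "coverable E (U \<times> V - E) (2 * card {{0::nat}})"
    by (rule coverable_selective[where \<phi> = "\<lambda>_. 0"]) (use assms in \<open>auto intro!: inj_onI\<close>)
  then show ?thesis by simp
qed

text \<open>A crude bound, wanted only to show that a realizer exists, so that the
  \<open>LEAST\<close> in the dimension is attained.\<close>

lemma coverable_finite:
  assumes "finite V"
  shows "coverable E (U \<times> V - E) (card V * 2)"
proof -
  have "coverable E (\<Union>b\<in>V. U \<times> {b} - E) (card V * 2)"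
    by (rule coverable_UN[OF assms], rule coverable_degree_le_1) auto
  then show ?thesis by (rule coverable_mono) auto
qed

section \<open>Greedy colouring of sparse conflict graphs\<close>

lemma degenerate_colouring:
  assumes "finite V" "\<And>v w. conf v w \<Longrightarrow> conf w v"
    and "\<And>S. S \<subseteq> V \<Longrightarrow> S \<noteq> {} \<Longrightarrow> \<exists>v\<in>S. card {w\<in>S. w \<noteq> v \<and> conf v w} \<le> d"
  shows "\<exists>\<phi>::'v \<Rightarrow> nat. (\<forall>v\<in>V. \<phi> v \<le> d) \<and> (\<forall>v\<in>V. \<forall>w\<in>V. v \<noteq> w \<longrightarrow> conf v w \<longrightarrow> \<phi> v \<noteq> \<phi> w)"
  using assms(1,3)
proof (induction V rule: finite_psubset_induct)
  case (psubset V)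
  show ?case
  proof (cases "V = {}")
    case False
    then obtain v where v: "v \<in> V" "card {w\<in>V. w \<noteq> v \<and> conf v w} \<le> d"
      using psubset.prems[of V] by blast
    have "\<exists>\<phi>::'v \<Rightarrow> nat. (\<forall>u\<in>V - {v}. \<phi> u \<le> d) \<and>
        (\<forall>u\<in>V - {v}. \<forall>w\<in>V - {v}. u \<noteq> w \<longrightarrow> conf u w \<longrightarrow> \<phi> u \<noteq> \<phi> w)"
      by (rule psubset.IH) (use v psubset.prems in auto)
    then obtain \<phi> :: "'v \<Rightarrow> nat" where \<phi>: "\<forall>u\<in>V - {v}. \<phi> u \<le> d"
      "\<forall>u\<in>V - {v}. \<forall>w\<in>V - {v}. u \<noteq> w \<longrightarrow> conf u w \<longrightarrow> \<phi> u \<noteq> \<phi> w"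
      by (elim exE conjE)
    define W where "W = {w\<in>V. w \<noteq> v \<and> conf v w}"
    have "card (\<phi> ` W) \<le> d"
      using card_image_le[of W \<phi>] v(2) psubset.hyps by (simp add: W_def)
    then have "\<not> {..d} \<subseteq> \<phi> ` W"
      using card_mono[of "\<phi> ` W" "{..d}"] psubset.hyps by (auto simp: W_def)
    then obtain x where x: "x \<le> d" "x \<notin> \<phi> ` W" by auto
    have new: "x \<noteq> \<phi> w" if "w \<in> V" "w \<noteq> v" "conf v w \<or> conf w v" for w
      using x(2) that assms(2) unfolding W_def by blast
    show ?thesis
    proof (intro exI[of _ "\<phi>(v := x)"] conjI ballI impI)
      fix u assume "u \<in> V"
      then show "(\<phi>(v := x)) u \<le> d" using \<phi>(1) x(1) by simp
    next
      fix u w assume "u \<in> V" "w \<in> V" "u \<noteq> w" "conf u w"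
      then show "(\<phi>(v := x)) u \<noteq> (\<phi>(v := x)) w"
        using \<phi>(2) new[of w] new[of u] by (cases "u = v"; cases "w = v") auto
    qed
  qed auto
qed

text \<open>The count is over ordered pairs, hence is the degree sum of the induced subgraph; if it
  is at most \<open>d * card S\<close>, some vertex of \<open>S\<close> has degree at most
  \<open>d\<close>.\<close>

lemma average_degree_colouring:
  assumes V: "finite V" and sym: "\<And>v w. conf v w \<Longrightarrow> conf w v"
    and sparse: "\<And>S. S \<subseteq> V \<Longrightarrow> S \<noteq> {} \<Longrightarrow>
      card {(v, w). v \<in> S \<and> w \<in> S \<and> v \<noteq> w \<and> conf v w} \<le> d * card S"
  shows "\<exists>\<phi>::'v \<Rightarrow> nat. (\<forall>v\<in>V. \<phi> v \<le> d) \<and> (\<forall>v\<in>V. \<forall>w\<in>V. v \<noteq> w \<longrightarrow> conf v w \<longrightarrow> \<phi> v \<noteq> \<phi> w)"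
proof (rule degenerate_colouring[OF V sym])
  fix S assume S: "S \<subseteq> V" "S \<noteq> {}"
  have fin: "finite S" using S V finite_subset by blast
  show "\<exists>v\<in>S. card {w\<in>S. w \<noteq> v \<and> conf v w} \<le> d"
  proof (rule ccontr)
    assume "\<not> ?thesis"
    then have "(\<Sum>v\<in>S. d) < (\<Sum>v\<in>S. card {w\<in>S. w \<noteq> v \<and> conf v w})"
      using S fin by (intro sum_strict_mono) auto
    also have "\<dots> = card (SIGMA v:S. {w\<in>S. w \<noteq> v \<and> conf v w})"
      using fin by (subst card_SigmaI) auto
    also have "(SIGMA v:S. {w\<in>S. w \<noteq> v \<and> conf v w})
        = {(v, w). v \<in> S \<and> w \<in> S \<and> v \<noteq> w \<and> conf v w}" by auto
    finally show False using sparse[OF S] by (simp add: mult.commute)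
  qed
qed

text \<open>A random \<open>\<omega> : {..<m} \<rightarrow> {0..r}\<close> selects the elements with value \<open>0\<close>.\<close>

lemma selective_fraction:
  assumes x: "x < m" and S: "S \<subseteq> {..<m}" "card S \<le> r" "x \<notin> S"
  shows "real (r + 1) ^ m \<le> 3 * real (r + 1) *
    real (card {\<omega> \<in> {..<m} \<rightarrow>\<^sub>E {0..r}. \<omega> x = 0 \<and> (\<forall>s\<in>S. \<omega> s \<noteq> 0)})"
proof -
  define F where "F i = (if i = x then {0} else if i \<in> S then {1..r} else {0..r})" for i
  have eq: "{\<omega> \<in> {..<m} \<rightarrow>\<^sub>E {0..r}. \<omega> x = 0 \<and> (\<forall>s\<in>S. \<omega> s \<noteq> 0)} = PiE {..<m} F" (is "?G = _")
  proof (intro set_eqI iffI)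
    fix \<omega> assume "\<omega> \<in> ?G"
    then show "\<omega> \<in> PiE {..<m} F" by (auto simp: F_def PiE_iff Suc_le_eq)
  next
    fix \<omega> assume w: "\<omega> \<in> PiE {..<m} F"
    have "\<omega> i \<in> {0..r}" if "i < m" for i
      using PiE_mem[OF w, of i] that by (auto simp: F_def split: if_splits)
    moreover have "\<omega> x = 0" using PiE_mem[OF w, of x] x by (simp add: F_def)
    moreover have "\<omega> s \<noteq> 0" if "s \<in> S" for s
      using PiE_mem[OF w, of s] S that by (auto simp: F_def split: if_splits)
    ultimately show "\<omega> \<in> ?G" using w by (auto simp: PiE_iff)
  qed
  have fin: "finite S" using S finite_subset by blast
  have cS: "card S \<le> m - 1"
    using card_mono[of "{..<m} - {x}" S] S x by auto
  have "card (PiE {..<m} F) = (\<Prod>i<m. card (F i))" by (simp add: card_PiE)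
  also have "\<dots> = card (F x) * (\<Prod>i\<in>{..<m} - {x}. card (F i))"
    using x by (intro prod.remove) auto
  also have "(\<Prod>i\<in>{..<m} - {x}. card (F i))
      = (\<Prod>i\<in>({..<m} - {x}) - S. card (F i)) * (\<Prod>i\<in>S. card (F i))"
    using S by (intro prod.subset_diff) auto
  also have "(\<Prod>i\<in>S. card (F i)) = r ^ card S"
    using S(3) by (subst prod.cong[of S S _ "\<lambda>_. r"]) (auto simp: F_def)
  also have "(\<Prod>i\<in>({..<m} - {x}) - S. card (F i)) = (r + 1) ^ (m - 1 - card S)"
  proof -
    have "card (({..<m} - {x}) - S) = m - 1 - card S"
      using S x fin by (subst card_Diff_subset) auto
    moreover have "(\<Prod>i\<in>({..<m} - {x}) - S. card (F i)) = (\<Prod>i\<in>({..<m} - {x}) - S. r + 1)"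
      by (intro prod.cong) (auto simp: F_def)
    ultimately show ?thesis by simp
  qed
  also have "card (F x) = 1" by (simp add: F_def)
  finally have card: "card (PiE {..<m} F) = (r + 1) ^ (m - 1 - card S) * r ^ card S"
    by (simp only: mult_1)
  \<comment> \<open>For \<open>r > 0\<close> this is \<open>(1 + 1 / r)^r \<le> e \<le> 3\<close>,
    the source of the factor 3 throughout. For \<open>r = 0\<close> also \<open>card S = 0\<close>,
    and both powers are 1.\<close>
  have key: "real (r + 1) ^ card S \<le> 3 * real r ^ card S"
  proof (cases "r = 0")
    case True
    then show ?thesis using S by simp
  next
    case False
    have "(1 + 1 / real r) ^ card S \<le> (1 + 1 / real r) ^ r"
      using S(2) by (intro power_increasing) auto
    also have "\<dots> \<le> exp 1"
      using exp_ge_one_plus_x_over_n_power_n[of "r" 1] False by simp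
    also have "\<dots> \<le> 3" by (rule exp_le)
    finally have "(1 + 1 / real r) ^ card S * real r ^ card S \<le> 3 * real r ^ card S"
      by (intro mult_right_mono) auto
    also have "(1 + 1 / real r) ^ card S * real r ^ card S = real (r + 1) ^ card S"
    proof -
      have "(1 + 1 / real r) * real r = real (r + 1)" using False by (simp add: field_simps)
      then show ?thesis by (simp only: power_mult_distrib[symmetric])
    qed
    finally show ?thesis .
  qed
  have "real (r + 1) ^ m = real (r + 1) * real (r + 1) ^ (m - 1 - card S) * real (r + 1) ^ card S"
  proof -
    have "m = 1 + (m - 1 - card S) + card S" using cS x by linarith
    then show ?thesis by (metis power_add power_one_right)
  qed
  also have "\<dots> \<le> real (r + 1) * real (r + 1) ^ (m - 1 - card S) * (3 * real r ^ card S)"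
    by (intro mult_left_mono key) auto
  finally show ?thesis unfolding eq card by (simp only: of_nat_mult of_nat_power mult_ac)
qed

text \<open>A subset is enumerated by a function on \<open>{..<r}\<close>, padded with the value
  \<open>m\<close>, which the intersection with \<open>{..<m}\<close> discards again.\<close>

lemma card_small_subsets:
  "card {S. S \<subseteq> {..<m} \<and> card S \<le> r} \<le> (m + 1) ^ r"
proof -
  have "{S. S \<subseteq> {..<m} \<and> card S \<le> r} \<subseteq> (\<lambda>f. f ` {..<r} \<inter> {..<m}) ` ({..<r} \<rightarrow>\<^sub>E {..m})"
  proof
    fix S assume "S \<in> {S. S \<subseteq> {..<m} \<and> card S \<le> r}"
    then have S: "S \<subseteq> {..<m}" "card S \<le> r" by auto
    then have "finite S" using finite_subset by blast
    then obtain e where e: "bij_betw e {..<card S} S"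
      using ex_bij_betw_nat_finite[of S] by (auto simp: lessThan_atLeast0)
    define f where "f = (\<lambda>i\<in>{..<r}. if i < card S then e i else m)"
    have "e i \<in> S" if "i < card S" for i using e that by (auto simp: bij_betw_def)
    then have "f \<in> {..<r} \<rightarrow>\<^sub>E {..m}" using S(1) by (force simp: f_def)
    moreover have "S = f ` {..<r} \<inter> {..<m}"
    proof -
      have "S = e ` {..<card S}" using e by (simp add: bij_betw_def)
      moreover have "f ` {..<r} \<inter> {..<m} = e ` {..<card S} \<inter> {..<m}"
        using S(2) by (auto simp: f_def image_iff split: if_splits)
      ultimately show ?thesis using S(1) by auto
    qed
    ultimately show "S \<in> (\<lambda>f. f ` {..<r} \<inter> {..<m}) ` ({..<r} \<rightarrow>\<^sub>E {..m})" by blast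
  qed
  then have "card {S. S \<subseteq> {..<m} \<and> card S \<le> r}
      \<le> card ((\<lambda>f. f ` {..<r} \<inter> {..<m}) ` ({..<r} \<rightarrow>\<^sub>E {..m}))"
    by (intro card_mono finite_imageI finite_PiE) auto
  also have "\<dots> \<le> card ({..<r} \<rightarrow>\<^sub>E {..m})"
    by (intro card_image_le finite_PiE) auto
  finally show ?thesis by (simp add: card_PiE)
qed

text \<open>A union bound in counting form. With \<open>\<delta> = 1 / (3 * (r + 1))\<close>, all
  \<open>t\<close> independent samples fail for a given pair \<open>(x, S)\<close> with probability
  at most \<open>(1 - \<delta>)^t \<le> exp (- \<delta> * t)\<close>, and there are at most
  \<open>(m + 1)^(r + 1)\<close> pairs; the assumption on \<open>t\<close> says exactly that the
  product of these two bounds is below 1.\<close>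

lemma selective_family:
  assumes t: "3 * real (r + 1) ^ 2 * ln (real (m + 1)) < real t"
  shows "\<exists>\<Q>. finite \<Q> \<and> card \<Q> \<le> t \<and> (\<forall>x<m. \<forall>S. S \<subseteq> {..<m} \<longrightarrow> card S \<le> r \<longrightarrow> x \<notin> S \<longrightarrow>
    (\<exists>Q\<in>\<Q>. x \<in> Q \<and> Q \<inter> S = {}))"
proof -
  define \<Omega> where "\<Omega> = ({..<m} \<rightarrow>\<^sub>E {0..r})"
  define P where "P = {(x, S). x < m \<and> S \<subseteq> {..<m} \<and> card S \<le> r \<and> x \<notin> S}"
  define good where "good z = {\<omega> \<in> \<Omega>. \<omega> (fst z) = 0 \<and> (\<forall>s\<in>snd z. \<omega> s \<noteq> 0)}" for z :: "nat \<times> nat set"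
  define bad where "bad z = ({..<t} \<rightarrow>\<^sub>E (\<Omega> - good z))" for z
  have fin\<Omega>: "finite \<Omega>" unfolding \<Omega>_def by (intro finite_PiE) auto
  have card\<Omega>: "card \<Omega> = (r + 1) ^ m" by (simp add: \<Omega>_def card_PiE)
  define \<delta> where "\<delta> = 1 / (3 * real (r + 1))"
  have \<delta>: "0 < \<delta>" "\<delta> \<le> 1" by (auto simp: \<delta>_def)
  have cardP: "real (card P) \<le> real (m + 1) ^ (r + 1)"
  proof -
    have "P \<subseteq> {..<m} \<times> {S. S \<subseteq> {..<m} \<and> card S \<le> r}" by (auto simp: P_def)
    then have "card P \<le> card ({..<m} \<times> {S. S \<subseteq> {..<m} \<and> card S \<le> r})"
      by (intro card_mono finite_cartesian_product) auto
    also have "\<dots> \<le> (m + 1) * (m + 1) ^ r"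
      unfolding card_cartesian_product by (intro mult_mono card_small_subsets) auto
    finally show ?thesis by (metis of_nat_mono of_nat_power power_Suc Suc_eq_plus1)
  qed
  have finP: "finite P"
    by (rule finite_subset[of _ "{..<m} \<times> Pow {..<m}"]) (auto simp: P_def)
  have cbad: "real (card (bad z)) \<le> (1 - \<delta>) ^ t * real (card \<Omega>) ^ t" if "z \<in> P" for z
  proof -
    have "real (r + 1) ^ m \<le> 3 * real (r + 1) * real (card (good z))"
      unfolding good_def \<Omega>_def by (rule selective_fraction) (use that in \<open>auto simp: P_def\<close>)
    then have "real (card \<Omega>) \<le> 3 * real (r + 1) * real (card (good z))"
      unfolding card\<Omega> by simp
    then have "\<delta> * real (card \<Omega>) \<le> real (card (good z))" by (simp add: \<delta>_def field_simps)
    moreover have "card (good z) \<le> card \<Omega>"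
      using fin\<Omega> by (intro card_mono) (auto simp: good_def)
    moreover have "card (\<Omega> - good z) = card \<Omega> - card (good z)"
      using fin\<Omega> by (intro card_Diff_subset) (auto simp: good_def)
    ultimately have "real (card (\<Omega> - good z)) \<le> (1 - \<delta>) * real (card \<Omega>)"
      by (simp add: of_nat_diff algebra_simps)
    then have "real (card (\<Omega> - good z)) ^ t \<le> ((1 - \<delta>) * real (card \<Omega>)) ^ t"
      by (intro power_mono) auto
    then show ?thesis by (simp add: bad_def card_PiE power_mult_distrib)
  qed
  have "real (card (\<Union>z\<in>P. bad z)) \<le> (\<Sum>z\<in>P. real (card (bad z)))"
    using card_UN_le[OF finP, of bad] by (metis of_nat_mono of_nat_sum)
  also have "\<dots> \<le> (\<Sum>z\<in>P. (1 - \<delta>) ^ t * real (card \<Omega>) ^ t)"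
    by (intro sum_mono cbad)
  also have "\<dots> = real (card P) * (1 - \<delta>) ^ t * real (card \<Omega>) ^ t" by simp
  also have "\<dots> < 1 * real (card \<Omega>) ^ t"
  proof (rule mult_strict_right_mono)
    have "real (r + 1) * ln (real (m + 1)) < \<delta> * real t"
      using t by (simp add: \<delta>_def field_simps power2_eq_square)
    then have lt: "exp (real (r + 1) * ln (real (m + 1))) * exp (- \<delta> * real t) < 1"
      by (simp add: exp_add[symmetric])
    have "(1 - \<delta>) ^ t \<le> exp (- \<delta>) ^ t"
      using \<delta> exp_ge_add_one_self[of "- \<delta>"] by (intro power_mono) auto
    also have "\<dots> = exp (- \<delta> * real t)" by (rule exp_of_nat2_mult[symmetric])
    finally have "real (card P) * (1 - \<delta>) ^ t \<le> real (m + 1) ^ (r + 1) * exp (- \<delta> * real t)"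
      using \<delta> by (intro mult_mono cardP) auto
    also have "real (m + 1) ^ (r + 1) = exp (real (r + 1) * ln (real (m + 1)))"
      by (subst exp_of_nat_mult) simp
    finally show "real (card P) * (1 - \<delta>) ^ t < 1" using lt by linarith
    show "0 < real (card \<Omega>) ^ t" by (simp add: card\<Omega>)
  qed
  also have "\<dots> = real (card ({..<t} \<rightarrow>\<^sub>E \<Omega>))" by (simp add: card_PiE)
  finally have "card (\<Union>z\<in>P. bad z) < card ({..<t} \<rightarrow>\<^sub>E \<Omega>)" by simp
  then have "\<not> ({..<t} \<rightarrow>\<^sub>E \<Omega>) \<subseteq> (\<Union>z\<in>P. bad z)"
    using finP fin\<Omega> card_mono[of "\<Union>z\<in>P. bad z" "{..<t} \<rightarrow>\<^sub>E \<Omega>"]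
    by (auto simp: bad_def finite_PiE)
  then obtain w where w: "w \<in> {..<t} \<rightarrow>\<^sub>E \<Omega>" "\<And>z. z \<in> P \<Longrightarrow> w \<notin> bad z" by blast
  define Q where "Q i = {x. w i x = 0}" for i
  show ?thesis
  proof (intro exI[of _ "Q ` {..<t}"] conjI allI impI)
    show "card (Q ` {..<t}) \<le> t" using card_image_le[of "{..<t}" Q] by simp
    fix x S assume xS: "x < m" "S \<subseteq> {..<m}" "card S \<le> r" "x \<notin> S"
    then have "w \<notin> bad (x, S)" using w(2) by (auto simp: P_def)
    then obtain i where i: "i < t" "w i \<notin> \<Omega> - good (x, S)"
      using w(1) unfolding bad_def by (auto simp: PiE_iff)
    then have "w i \<in> good (x, S)" using PiE_mem[OF w(1), of i] by blast
    then have "x \<in> Q i" "Q i \<inter> S = {}" by (auto simp: good_def Q_def)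
    then show "\<exists>Q\<in>Q ` {..<t}. x \<in> Q \<and> Q \<inter> S = {}" using i by blast
  qed simp
qed

text \<open>Each \<open>a\<close> makes its neighbours in \<open>S\<close> a clique of conflicts, at
  most \<open>r^2\<close> ordered pairs, and contributes only if it has two neighbours there; so the
  conflict graph has average degree at most \<open>M * r^2\<close> on every \<open>S\<close>. The
  colours \<open>0..M * r^2\<close> are \<open>M * r^2 + 1\<close> in number, which explains the
  \<open>+ 2\<close> in the logarithm.\<close>

lemma coverable_low_degree:
  fixes E :: "('a \<times> 'b) set"
  assumes V: "finite V" and U: "finite U"
    and deg: "\<And>a. a \<in> U \<Longrightarrow> card {b\<in>V. (a, b) \<in> E} \<le> r"
    and sparse: "\<And>S. S \<subseteq> V \<Longrightarrow> S \<noteq> {} \<Longrightarrow>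
      card {a\<in>U. 2 \<le> card {b\<in>S. (a, b) \<in> E}} \<le> M * card S"
    and t: "3 * real (r + 1) ^ 2 * ln (real (M * r\<^sup>2 + 2)) < real t"
  shows "coverable E (U \<times> V - E) (2 * t)"
proof -
  define conf where "conf b b' \<longleftrightarrow> (\<exists>a\<in>U. (a, b) \<in> E \<and> (a, b') \<in> E)" for b b'
  have "\<exists>\<phi>::'b \<Rightarrow> nat. (\<forall>v\<in>V. \<phi> v \<le> M * r\<^sup>2) \<and>
      (\<forall>v\<in>V. \<forall>w\<in>V. v \<noteq> w \<longrightarrow> conf v w \<longrightarrow> \<phi> v \<noteq> \<phi> w)"
  proof (rule average_degree_colouring[OF V])
    show "conf w v" if "conf v w" for v w using that by (auto simp: conf_def)
  next
    fix S assume S: "S \<subseteq> V" "S \<noteq> {}"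
    define N where "N a = {b\<in>S. (a, b) \<in> E}" for a
    define T where "T = {a\<in>U. 2 \<le> card (N a)}"
    have fS: "finite S" using S V finite_subset by blast
    then have fN: "finite (N a)" for a by (simp add: N_def)
    have fT: "finite T" using U by (simp add: T_def)
    have "a \<in> T" if "a \<in> U" "b \<in> N a" "b' \<in> N a" "b \<noteq> b'" for a b b'
    proof -
      have "card {b, b'} \<le> card (N a)" using that fN by (intro card_mono) auto
      then show ?thesis using that by (simp add: T_def)
    qed
    then have "{(v, w). v \<in> S \<and> w \<in> S \<and> v \<noteq> w \<and> conf v w} \<subseteq> (\<Union>a\<in>T. N a \<times> N a)"
      unfolding conf_def N_def by blast
    then have "card {(v, w). v \<in> S \<and> w \<in> S \<and> v \<noteq> w \<and> conf v w} \<le> card (\<Union>a\<in>T. N a \<times> N a)"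
      using fT fN by (intro card_mono) auto
    also have "\<dots> \<le> (\<Sum>a\<in>T. card (N a \<times> N a))" using fT by (rule card_UN_le)
    also have "\<dots> \<le> (\<Sum>a\<in>T. r\<^sup>2)"
    proof (rule sum_mono)
      fix a assume "a \<in> T"
      then have "card (N a) \<le> r"
        using deg[of a] card_mono[of "{b\<in>V. (a, b) \<in> E}" "N a"] V S by (force simp: N_def T_def)
      then show "card (N a \<times> N a) \<le> r\<^sup>2"
        by (simp add: card_cartesian_product power2_eq_square mult_mono)
    qed
    also have "\<dots> = card T * r\<^sup>2" by simp
    also have "\<dots> \<le> M * card S * r\<^sup>2"
      using sparse[OF S] by (intro mult_right_mono) (auto simp: T_def N_def)
    finally show "card {(v, w). v \<in> S \<and> w \<in> S \<and> v \<noteq> w \<and> conf v w} \<le> M * r\<^sup>2 * card S"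
      by (simp add: mult_ac)
  qed
  then obtain \<phi> :: "'b \<Rightarrow> nat" where bound: "\<forall>v\<in>V. \<phi> v \<le> M * r\<^sup>2"
    and rainbow: "\<forall>v\<in>V. \<forall>w\<in>V. v \<noteq> w \<longrightarrow> conf v w \<longrightarrow> \<phi> v \<noteq> \<phi> w"
    by (elim exE conjE)
  define m where "m = M * r\<^sup>2 + 1"
  obtain \<Q> where Q: "finite \<Q>" "card \<Q> \<le> t"
    and sel: "\<And>x S. x < m \<Longrightarrow> S \<subseteq> {..<m} \<Longrightarrow> card S \<le> r \<Longrightarrow> x \<notin> S \<Longrightarrow> \<exists>Q\<in>\<Q>. x \<in> Q \<and> Q \<inter> S = {}"
    using selective_family[of r m t] t unfolding m_def by (auto simp: add.commute)
  have "coverable E (U \<times> V - E) (2 * card \<Q>)"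
  proof (rule coverable_selective[OF V Q(1), where \<phi> = \<phi>])
    show "inj_on \<phi> {b\<in>V. (a, b) \<in> E}" if "a \<in> U" for a
      using rainbow that unfolding inj_on_def conf_def by blast
  next
    fix a b assume ab: "a \<in> U" "b \<in> V" "(a, b) \<notin> E"
    \<comment> \<open>The colour of \<open>b\<close> is removed because one neighbour of
      \<open>a\<close> may share it: \<open>b\<close> itself is not adjacent to \<open>a\<close>, so
      the colouring need not separate it from the neighbours of \<open>a\<close>.\<close>
    define S where "S = \<phi> ` {b'\<in>V. (a, b') \<in> E} - {\<phi> b}"
    have "card S \<le> card (\<phi> ` {b'\<in>V. (a, b') \<in> E})"
      unfolding S_def using V by (intro card_mono) auto
    also have "\<dots> \<le> card {b'\<in>V. (a, b') \<in> E}" using V by (intro card_image_le) auto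
    also have "\<dots> \<le> r" by (rule deg[OF ab(1)])
    finally have "card S \<le> r" .
    moreover have "S \<subseteq> {..<m}" "\<phi> b < m" "\<phi> b \<notin> S"
      using bound ab by (auto simp: S_def m_def less_Suc_eq_le)
    ultimately obtain Q where "Q \<in> \<Q>" "\<phi> b \<in> Q" "Q \<inter> S = {}" using sel by blast
    then show "\<exists>Q\<in>\<Q>. \<phi> b \<in> Q \<and> (\<forall>b'\<in>V. (a, b') \<in> E \<longrightarrow> \<phi> b' \<noteq> \<phi> b \<longrightarrow> \<phi> b' \<notin> Q)"
      unfolding S_def by blast
  qed
  then show ?thesis by (rule coverable_mono) (use Q in auto)
qed

section \<open>Star colourings of sparse bipartite graphs\<close>

text \<open>Vertices of degree at most \<open>k\<close> are removed one at a time, and every edge is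
  oriented away from the end that is removed first. \<open>E1\<close> collects the edges whose left
  end went first, \<open>E2\<close> the others.\<close>

lemma orientation:
  fixes E :: "('a \<times> 'b) set"
  assumes "finite X" "finite B"
    and "\<And>S T. S \<subseteq> X \<Longrightarrow> T \<subseteq> B \<Longrightarrow> S \<noteq> {} \<or> T \<noteq> {} \<Longrightarrow>
      (\<exists>a\<in>S. card {b\<in>T. (a, b) \<in> E} \<le> k) \<or> (\<exists>b\<in>T. card {a\<in>S. (a, b) \<in> E} \<le> k)"
  shows "\<exists>E1 E2. E \<inter> X \<times> B = E1 \<union> E2 \<and>
    (\<forall>a. card {b. (a, b) \<in> E1} \<le> k) \<and> (\<forall>b. card {a. (a, b) \<in> E2} \<le> k)"
  using assms
proof (induction "card X + card B" arbitrary: X B rule: less_induct)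
  case less
  show ?case
  proof (cases "X = {} \<and> B = {}")
    case True
    then show ?thesis by (intro exI[of _ "{}"]) auto
  next
    case False
    then consider (left) a where "a \<in> X" "card {b\<in>B. (a, b) \<in> E} \<le> k"
      | (right) b where "b \<in> B" "card {a\<in>X. (a, b) \<in> E} \<le> k"
      using less.prems(3)[of X B] by blast
    then show ?thesis
    proof cases
      case left
      have "\<exists>E1 E2. E \<inter> (X - {a}) \<times> B = E1 \<union> E2 \<and>
          (\<forall>a. card {b. (a, b) \<in> E1} \<le> k) \<and> (\<forall>b. card {a. (a, b) \<in> E2} \<le> k)"
        by (rule less.hyps; (intro less.prems(3))?)
          (use less.prems(1,2) left(1) card_Diff1_less[of X a] in auto)
      then obtain E1 E2 where 1: "E \<inter> (X - {a}) \<times> B = E1 \<union> E2"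
        "\<forall>a. card {b. (a, b) \<in> E1} \<le> k" "\<forall>b. card {a. (a, b) \<in> E2} \<le> k" by (elim exE conjE)
      define F where "F = E1 \<union> {a} \<times> {b\<in>B. (a, b) \<in> E}"
      have none: "(a, b) \<notin> E1" for b using 1(1) by blast
      have "card {b. (x, b) \<in> F} \<le> k" for x
      proof (cases "x = a")
        case True
        then have "{b. (x, b) \<in> F} = {b\<in>B. (a, b) \<in> E}" using none by (auto simp: F_def)
        then show ?thesis using left(2) by simp
      next
        case False
        then have "{b. (x, b) \<in> F} = {b. (x, b) \<in> E1}" by (auto simp: F_def)
        then show ?thesis using 1(2) by simp
      qed
      moreover have "E \<inter> X \<times> B = F \<union> E2"
      proof -
        have "E \<inter> X \<times> B = (E \<inter> (X - {a}) \<times> B) \<union> {a} \<times> {b\<in>B. (a, b) \<in> E}" using left(1) by auto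
        then show ?thesis unfolding 1(1) F_def by auto
      qed
      ultimately show ?thesis using 1(3) by blast
    next
      case right
      have "\<exists>E1 E2. E \<inter> X \<times> (B - {b}) = E1 \<union> E2 \<and>
          (\<forall>a. card {b. (a, b) \<in> E1} \<le> k) \<and> (\<forall>b. card {a. (a, b) \<in> E2} \<le> k)"
        by (rule less.hyps; (intro less.prems(3))?)
          (use less.prems(1,2) right(1) card_Diff1_less[of B b] in auto)
      then obtain E1 E2 where 1: "E \<inter> X \<times> (B - {b}) = E1 \<union> E2"
        "\<forall>a. card {b. (a, b) \<in> E1} \<le> k" "\<forall>b. card {a. (a, b) \<in> E2} \<le> k" by (elim exE conjE)
      define F where "F = E2 \<union> {a\<in>X. (a, b) \<in> E} \<times> {b}"
      have none: "(a, b) \<notin> E2" for a using 1(1) by blast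
      have "card {a. (a, x) \<in> F} \<le> k" for x
      proof (cases "x = b")
        case True
        then have "{a. (a, x) \<in> F} = {a\<in>X. (a, b) \<in> E}" using none by (auto simp: F_def)
        then show ?thesis using right(2) by simp
      next
        case False
        then have "{a. (a, x) \<in> F} = {a. (a, x) \<in> E2}" by (auto simp: F_def)
        then show ?thesis using 1(3) by simp
      qed
      moreover have "E \<inter> X \<times> B = E1 \<union> F"
      proof -
        have "E \<inter> X \<times> B = (E \<inter> X \<times> (B - {b})) \<union> {a\<in>X. (a, b) \<in> E} \<times> {b}" using right(1) by auto
        then show ?thesis unfolding 1(1) F_def by auto
      qed
      ultimately show ?thesis using 1(2) by blast
    qed
  qed
qed

text \<open>Think of the edges in \<open>E1\<close> as oriented from left to right and those in \<open>E2\<close> as oriented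
  from right to left. The colouring separates the out-neighbours of a left vertex from each other and
  from its in-neighbours.\<close>

lemma star_colouring:
  fixes E1 E2 :: "('a \<times> 'b) set"
  assumes X: "finite X" and B: "finite B" and sub: "E1 \<union> E2 \<subseteq> X \<times> B"
    and out1: "\<And>a. card {b. (a, b) \<in> E1} \<le> 2"
    and out2: "\<And>b. card {a. (a, b) \<in> E2} \<le> 2"
    and sparse: "\<And>S. S \<subseteq> B \<Longrightarrow> S \<noteq> {} \<Longrightarrow>
      card {a\<in>X. 2 \<le> card {b\<in>S. (a, b) \<in> E1 \<union> E2}} \<le> 2 * card S"
  shows "\<exists>\<psi>::'b \<Rightarrow> nat. (\<forall>b\<in>B. \<psi> b \<le> 16) \<and>
    (\<forall>a b b'. (a, b) \<in> E1 \<longrightarrow> (a, b') \<in> E1 \<union> E2 \<longrightarrow> b \<noteq> b' \<longrightarrow> \<psi> b \<noteq> \<psi> b')"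
proof -
  define conf where "conf b b' \<longleftrightarrow> (\<exists>a. (a, b) \<in> E1 \<and> (a, b') \<in> E1 \<union> E2 \<or> (a, b') \<in> E1 \<and> (a, b) \<in> E1 \<union> E2)" for b b'
  define N1 where "N1 a = {b. (a, b) \<in> E1}" for a
  define N2 where "N2 b = {a. (a, b) \<in> E2}" for b
  have fN1: "finite (N1 a)" for a
    by (rule finite_subset[OF _ B]) (use sub in \<open>auto simp: N1_def\<close>)
  have fN2: "finite (N2 b)" for b
    by (rule finite_subset[OF _ X]) (use sub in \<open>auto simp: N2_def\<close>)
  have "\<exists>\<psi>::'b \<Rightarrow> nat. (\<forall>v\<in>B. \<psi> v \<le> 16) \<and>
      (\<forall>v\<in>B. \<forall>w\<in>B. v \<noteq> w \<longrightarrow> conf v w \<longrightarrow> \<psi> v \<noteq> \<psi> w)"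
  proof (rule average_degree_colouring[OF B])
    show "conf w v" if "conf v w" for v w using that by (auto simp: conf_def)
  next
    fix S assume S: "S \<subseteq> B" "S \<noteq> {}"
    define T where "T = {a\<in>X. 2 \<le> card {b\<in>S. (a, b) \<in> E1 \<union> E2}}"
    \<comment> \<open>\<open>C\<close> holds the conflicts along two consecutive out-edges, from
      \<open>b\<close> to \<open>a\<close> and from \<open>a\<close> on: at most
      \<open>2 * 2\<close> for each \<open>b\<close>, without any sparsity. Conflicts between two
      out-neighbours of the same \<open>a\<close> force \<open>a\<close> into \<open>T\<close> and
      number at most \<open>4 * card T \<le> 8 * card S\<close>. Together with the converse of
      \<open>C\<close> this gives \<open>8 + 4 + 4 = 16\<close>.\<close>
    define C where "C = (\<Union>b\<in>S. \<Union>a\<in>N2 b. N1 a \<times> {b})"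
    have fS: "finite S" using S B finite_subset by blast
    have fT: "finite T" using X by (simp add: T_def)
    have finC: "finite C" unfolding C_def using fS fN1 fN2 by blast
    have inT: "a \<in> T" if "(a, b) \<in> E1 \<union> E2" "(a, b') \<in> E1 \<union> E2" "b \<in> S" "b' \<in> S" "b \<noteq> b'" for a b b'
    proof -
      have "card {b, b'} \<le> card {b\<in>S. (a, b) \<in> E1 \<union> E2}"
        using that fS by (intro card_mono) auto
      then show ?thesis using that sub by (auto simp: T_def)
    qed
    have "card (N1 a \<times> N1 a) \<le> 4" for a
    proof -
      have "card (N1 a) * card (N1 a) \<le> 2 * 2" using out1[of a] by (intro mult_mono) (auto simp: N1_def)
      then show ?thesis by (simp add: card_cartesian_product)
    qed
    then have "card (\<Union>a\<in>T. N1 a \<times> N1 a) \<le> card T * 4"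
      using card_UN_le[OF fT, of "\<lambda>a. N1 a \<times> N1 a"] sum_bounded_above[of T "\<lambda>a. card (N1 a \<times> N1 a)" 4]
      by fastforce
    also have "\<dots> \<le> 8 * card S" using sparse[OF S] by (simp add: T_def)
    finally have c1: "card (\<Union>a\<in>T. N1 a \<times> N1 a) \<le> 8 * card S" .
    have "card (\<Union>a\<in>N2 b. N1 a \<times> {b}) \<le> 4" for b
    proof -
      have "card (\<Union>a\<in>N2 b. N1 a \<times> {b}) \<le> (\<Sum>a\<in>N2 b. card (N1 a \<times> {b}))"
        by (rule card_UN_le[OF fN2])
      also have "\<dots> \<le> (\<Sum>a\<in>N2 b. 2)"
        using out1 by (intro sum_mono) (auto simp: N1_def card_cartesian_product)
      also have "\<dots> \<le> 4" using out2[of b] by (simp add: N2_def)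
      finally show ?thesis .
    qed
    then have c2: "card C \<le> 4 * card S"
      unfolding C_def using card_UN_le[OF fS, of "\<lambda>b. \<Union>a\<in>N2 b. N1 a \<times> {b}"]
        sum_bounded_above[of S "\<lambda>b. card (\<Union>a\<in>N2 b. N1 a \<times> {b})" 4] by fastforce
    have c3: "card (C\<inverse>) = card C" by simp
    have "(v, w) \<in> (\<Union>a\<in>T. N1 a \<times> N1 a)"
      if vw: "v \<in> S" "w \<in> S" "v \<noteq> w" "conf v w" "(v, w) \<notin> C\<inverse>" "(v, w) \<notin> C" for v w
    proof -
      obtain a where "(a, v) \<in> E1 \<and> (a, w) \<in> E1 \<union> E2 \<or> (a, w) \<in> E1 \<and> (a, v) \<in> E1 \<union> E2"
        using vw(4) unfolding conf_def by blast
      then have "(a, v) \<in> E1" "(a, w) \<in> E1"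
        using vw by (auto simp: C_def N1_def N2_def)
      then show "(v, w) \<in> (\<Union>a\<in>T. N1 a \<times> N1 a)"
        using inT[of a v w] vw by (auto simp: N1_def)
    qed
    then have "{(v, w). v \<in> S \<and> w \<in> S \<and> v \<noteq> w \<and> conf v w} \<subseteq> (\<Union>a\<in>T. N1 a \<times> N1 a) \<union> C \<union> C\<inverse>"
      by blast
    then have "card {(v, w). v \<in> S \<and> w \<in> S \<and> v \<noteq> w \<and> conf v w}
        \<le> card ((\<Union>a\<in>T. N1 a \<times> N1 a) \<union> C \<union> C\<inverse>)"
      using fT fN1 finC by (intro card_mono) auto
    also have "\<dots> \<le> card (\<Union>a\<in>T. N1 a \<times> N1 a) + card C + card (C\<inverse>)"
      using card_Un_le[of "(\<Union>a\<in>T. N1 a \<times> N1 a) \<union> C" "C\<inverse>"] card_Un_le[of "\<Union>a\<in>T. N1 a \<times> N1 a" C]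
      by linarith
    finally show "card {(v, w). v \<in> S \<and> w \<in> S \<and> v \<noteq> w \<and> conf v w} \<le> 16 * card S"
      using c1 c2 c3 by linarith
  qed
  then obtain \<psi> :: "'b \<Rightarrow> nat" where psi: "\<forall>v\<in>B. \<psi> v \<le> 16"
    "\<forall>v\<in>B. \<forall>w\<in>B. v \<noteq> w \<longrightarrow> conf v w \<longrightarrow> \<psi> v \<noteq> \<psi> w" by (elim exE conjE)
  have "\<psi> b \<noteq> \<psi> b'" if "(a, b) \<in> E1" "(a, b') \<in> E1 \<union> E2" "b \<noteq> b'" for a b b'
  proof -
    have "b \<in> B" "b' \<in> B" "conf b b'" using that sub by (auto simp: conf_def)
    then show ?thesis using psi(2) that(3) by blast
  qed
  then show ?thesis using psi(1) by blast
qed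

text \<open>Between two colour classes every edge has an end of degree one, so that two orders for each
  side suffice.\<close>

lemma coverable_star:
  fixes E :: "('a \<times> 'b) set"
  assumes X: "finite X" and B: "finite B"
    and sparseB: "\<And>S. S \<subseteq> B \<Longrightarrow> S \<noteq> {} \<Longrightarrow> card {a\<in>X. 2 \<le> card {b\<in>S. (a, b) \<in> E}} \<le> 2 * card S"
    and sparseX: "\<And>S. S \<subseteq> X \<Longrightarrow> S \<noteq> {} \<Longrightarrow> card {b\<in>B. 2 \<le> card {a\<in>S. (a, b) \<in> E}} \<le> 2 * card S"
    and degenerate: "\<And>S T. S \<subseteq> X \<Longrightarrow> T \<subseteq> B \<Longrightarrow> S \<noteq> {} \<or> T \<noteq> {} \<Longrightarrow>
      (\<exists>a\<in>S. card {b\<in>T. (a, b) \<in> E} \<le> 2) \<or> (\<exists>b\<in>T. card {a\<in>S. (a, b) \<in> E} \<le> 2)"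
  shows "coverable E (X \<times> B - E) 1156"
proof -
  have "\<exists>E1 E2. E \<inter> X \<times> B = E1 \<union> E2 \<and>
      (\<forall>a. card {b. (a, b) \<in> E1} \<le> 2) \<and> (\<forall>b. card {a. (a, b) \<in> E2} \<le> 2)"
    by (rule orientation[OF X B]) (rule degenerate)
  then obtain E1 E2 where E12: "E \<inter> X \<times> B = E1 \<union> E2"
    and out: "\<forall>a. card {b. (a, b) \<in> E1} \<le> 2" "\<forall>b. card {a. (a, b) \<in> E2} \<le> 2"
    by (elim exE conjE)
  have sub: "E1 \<union> E2 \<subseteq> X \<times> B" using E12 by blast
  have "\<exists>\<psi>::'b \<Rightarrow> nat. (\<forall>b\<in>B. \<psi> b \<le> 16) \<and>
    (\<forall>a b b'. (a, b) \<in> E1 \<longrightarrow> (a, b') \<in> E1 \<union> E2 \<longrightarrow> b \<noteq> b' \<longrightarrow> \<psi> b \<noteq> \<psi> b')"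
  proof (rule star_colouring[OF X B sub])
    fix S assume S: "S \<subseteq> B" "S \<noteq> {}"
    have "{b\<in>S. (a, b) \<in> E1 \<union> E2} = {b\<in>S. (a, b) \<in> E}" if "a \<in> X" for a
      using that S unfolding E12[symmetric] by auto
    then have "{a\<in>X. 2 \<le> card {b\<in>S. (a, b) \<in> E1 \<union> E2}} = {a\<in>X. 2 \<le> card {b\<in>S. (a, b) \<in> E}}"
      by auto
    then show "card {a\<in>X. 2 \<le> card {b\<in>S. (a, b) \<in> E1 \<union> E2}} \<le> 2 * card S"
      using sparseB[OF S] by simp
  qed (use out in auto)
  then obtain \<psi> :: "'b \<Rightarrow> nat" where psi: "\<forall>b\<in>B. \<psi> b \<le> 16"
    "\<forall>a b b'. (a, b) \<in> E1 \<longrightarrow> (a, b') \<in> E1 \<union> E2 \<longrightarrow> b \<noteq> b' \<longrightarrow> \<psi> b \<noteq> \<psi> b'"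
    by (elim exE conjE)
  have "\<exists>\<phi>::'a \<Rightarrow> nat. (\<forall>a\<in>X. \<phi> a \<le> 16) \<and>
    (\<forall>b a a'. (b, a) \<in> E2\<inverse> \<longrightarrow> (b, a') \<in> E2\<inverse> \<union> E1\<inverse> \<longrightarrow> a \<noteq> a' \<longrightarrow> \<phi> a \<noteq> \<phi> a')"
  proof (rule star_colouring[OF B X])
    fix S assume S: "S \<subseteq> X" "S \<noteq> {}"
    have "{a\<in>S. (b, a) \<in> E2\<inverse> \<union> E1\<inverse>} = {a\<in>S. (a, b) \<in> E}" if "b \<in> B" for b
      using that S E12 by auto
    then have "{b\<in>B. 2 \<le> card {a\<in>S. (b, a) \<in> E2\<inverse> \<union> E1\<inverse>}} = {b\<in>B. 2 \<le> card {a\<in>S. (a, b) \<in> E}}"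
      by auto
    then show "card {b\<in>B. 2 \<le> card {a\<in>S. (b, a) \<in> E2\<inverse> \<union> E1\<inverse>}} \<le> 2 * card S"
      using sparseX[OF S] by simp
  qed (use out sub in auto)
  then obtain \<phi> :: "'a \<Rightarrow> nat" where phi: "\<forall>a\<in>X. \<phi> a \<le> 16"
    "\<forall>b a a'. (b, a) \<in> E2\<inverse> \<longrightarrow> (b, a') \<in> E2\<inverse> \<union> E1\<inverse> \<longrightarrow> a \<noteq> a' \<longrightarrow> \<phi> a \<noteq> \<phi> a'"
    by (elim exE conjE)
  define XA where "XA i = {a\<in>X. \<phi> a = i}" for i
  define BB where "BB j = {b\<in>B. \<psi> b = j}" for j
  have pair: "coverable E (XA i \<times> BB j - E) 4" for i j
  proof -
    \<comment> \<open>A left vertex with two neighbours in the class has no out-edge into it, since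
      \<open>\<psi>\<close> separates an out-neighbour from all other neighbours. Outside
      \<open>A1\<close> all edges to the class therefore lie in \<open>E2\<close>, and
      \<open>\<phi>\<close> lets a right vertex have at most one out-neighbour of a given
      colour.\<close>
    define A1 where "A1 = {a\<in>XA i. \<forall>x\<in>BB j. \<forall>y\<in>BB j. (a, x) \<in> E \<longrightarrow> (a, y) \<in> E \<longrightarrow> x = y}"
    have "coverable E (A1 \<times> BB j - E) 2"
      by (rule coverable_degree_le_1) (use B in \<open>auto simp: BB_def A1_def\<close>)
    moreover have "coverable (E\<inverse>) (BB j \<times> (XA i - A1) - E\<inverse>) 2"
    proof (rule coverable_degree_le_1)
      show "finite (XA i - A1)" using X by (simp add: XA_def)
      have E2: "(a, b) \<in> E2" if "a \<in> XA i - A1" "b \<in> BB j" "(a, b) \<in> E" for a b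
      proof (rule ccontr)
        assume "(a, b) \<notin> E2"
        then have b: "(a, b) \<in> E1" using that E12 by (auto simp: XA_def BB_def)
        have "x = b" if "x \<in> BB j" "(a, x) \<in> E" for x
        proof (rule ccontr)
          assume "x \<noteq> b"
          have "(a, x) \<in> E1 \<union> E2"
            using that \<open>a \<in> XA i - A1\<close> E12 by (auto simp: XA_def BB_def)
          then have "\<psi> b \<noteq> \<psi> x" using psi(2) b \<open>x \<noteq> b\<close> by blast
          then show False using that \<open>b \<in> BB j\<close> by (simp add: BB_def)
        qed
        then have "a \<in> A1" using that unfolding A1_def by blast
        then show False using that by blast
      qed
      fix b x y assume h: "b \<in> BB j" "x \<in> XA i - A1" "y \<in> XA i - A1" "(b, x) \<in> E\<inverse>" "(b, y) \<in> E\<inverse>"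
      then have "(x, b) \<in> E2" "(y, b) \<in> E2" using E2 by auto
      moreover have "\<phi> x = \<phi> y" using h by (auto simp: XA_def)
      ultimately show "x = y" using phi(2) by (meson UnI1 converseI)
    qed
    then have "coverable E ((BB j \<times> (XA i - A1) - E\<inverse>)\<inverse>) 2"
      using coverable_converse[of "E\<inverse>"] by simp
    ultimately have "coverable E ((A1 \<times> BB j - E) \<union> (BB j \<times> (XA i - A1) - E\<inverse>)\<inverse>) (2 + 2)"
      by (rule coverable_Un)
    then show ?thesis by (rule coverable_mono) auto
  qed
  \<comment> \<open>The colours run from 0 to 16, so there are \<open>17^2 = 289\<close> pairs of
    classes with 4 orders each, 1156 in all.\<close>
  have "coverable E (\<Union>(i, j)\<in>{..16} \<times> {..16}. XA i \<times> BB j - E) (card ({..16::nat} \<times> {..16::nat}) * 4)"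
    by (rule coverable_UN) (use pair in auto)
  moreover have "X \<times> B - E \<subseteq> (\<Union>(i, j)\<in>{..16} \<times> {..16}. XA i \<times> BB j - E)"
    using psi(1) phi(1) by (auto simp: XA_def BB_def)
  ultimately show ?thesis by (rule coverable_mono) simp
qed

section \<open>Dimension of bipartite posets\<close>

text \<open>The deterministic core of the upper bound. The sparsity assumptions cover sets up to
  size \<open>s0\<close> only. For a larger \<open>S\<close> inside a block,
  \<open>card A \<le> M * s0\<close> bounds everything by \<open>M * card S\<close>; on the
  exceptional side no such loss occurs, because there are at most \<open>s0\<close> exceptional
  vertices.\<close>

lemma coverable_sparse:
  fixes E :: "('a \<times> 'b) set"
  assumes A: "finite A" and B: "finite B" and M: "2 \<le> M" "card A \<le> M * s0"
    and two_left: "\<And>S. S \<subseteq> B \<Longrightarrow> S \<noteq> {} \<Longrightarrow> card S \<le> s0 \<Longrightarrow>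
      card {a\<in>A. 2 \<le> card {b\<in>S. (a, b) \<in> E}} \<le> 2 * card S"
    and two_right: "\<And>S. S \<subseteq> A \<Longrightarrow> S \<noteq> {} \<Longrightarrow> card S \<le> s0 \<Longrightarrow>
      card {b\<in>B. 2 \<le> card {a\<in>S. (a, b) \<in> E}} \<le> 2 * card S"
    and three_left: "\<And>S. S \<subseteq> B \<Longrightarrow> S \<noteq> {} \<Longrightarrow> card S \<le> s0 \<Longrightarrow>
      card {a\<in>A. 3 \<le> card {b\<in>S. (a, b) \<in> E}} < card S"
    and three_right: "\<And>S. S \<subseteq> A \<Longrightarrow> S \<noteq> {} \<Longrightarrow> card S \<le> s0 \<Longrightarrow>
      card {b\<in>B. 3 \<le> card {a\<in>S. (a, b) \<in> E}} < card S"
    and Y: "B = (\<Union>i<q. Y i)"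
    and exceptional: "card {a\<in>A. \<exists>i<q. r < card {b\<in>Y i. (a, b) \<in> E}} \<le> s0"
    and t: "3 * real (r + 1) ^ 2 * ln (real (M * r\<^sup>2 + 2)) < real t"
  shows "coverable E (A \<times> B - E) (q * (2 * t) + 1156)"
proof -
  define X where "X = {a\<in>A. \<exists>i<q. r < card {b\<in>Y i. (a, b) \<in> E}}"
  define U where "U i = {a\<in>A. card {b\<in>Y i. (a, b) \<in> E} \<le> r}" for i
  have X: "X \<subseteq> A" "finite X" "card X \<le> s0" using A exceptional by (auto simp: X_def)
  have low: "coverable E (U i \<times> Y i - E) (2 * t)" if "i < q" for i
  proof (rule coverable_low_degree[OF _ _ _ _ t])
    have YB: "Y i \<subseteq> B" using Y that by blast
    then show "finite (Y i)" using B finite_subset by blast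
    show fU: "finite (U i)" using A by (simp add: U_def)
    show "card {b \<in> Y i. (a, b) \<in> E} \<le> r" if "a \<in> U i" for a using that by (simp add: U_def)
    fix S assume S: "S \<subseteq> Y i" "S \<noteq> {}"
    have le: "card {a\<in>U i. 2 \<le> card {b\<in>S. (a, b) \<in> E}} \<le> card {a\<in>A. 2 \<le> card {b\<in>S. (a, b) \<in> E}}"
      using A by (intro card_mono) (auto simp: U_def)
    show "card {a\<in>U i. 2 \<le> card {b\<in>S. (a, b) \<in> E}} \<le> M * card S"
    proof (cases "card S \<le> s0")
      case True
      then have "card {a\<in>A. 2 \<le> card {b\<in>S. (a, b) \<in> E}} \<le> 2 * card S"
        using S YB by (intro two_left) auto
      also have "\<dots> \<le> M * card S" using M(1) by simp
      finally show ?thesis using le by linarith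
    next
      case False
      have "card {a\<in>A. 2 \<le> card {b\<in>S. (a, b) \<in> E}} \<le> card A" using A by (intro card_mono) auto
      also have "\<dots> \<le> M * card S" using M(2) False by (meson mult_le_mono2 nat_le_linear order_trans)
      finally show ?thesis using le by linarith
    qed
  qed
  have "coverable E (\<Union>i<q. U i \<times> Y i - E) (card {..<q} * (2 * t))"
    by (rule coverable_UN) (use low in auto)
  moreover have "coverable E (X \<times> B - E) 1156"
  proof (rule coverable_star[OF X(2) B])
    fix S assume S: "S \<subseteq> B" "S \<noteq> {}"
    show "card {a\<in>X. 2 \<le> card {b\<in>S. (a, b) \<in> E}} \<le> 2 * card S"
    proof (cases "card S \<le> s0")
      case True
      have "card {a\<in>X. 2 \<le> card {b\<in>S. (a, b) \<in> E}} \<le> card {a\<in>A. 2 \<le> card {b\<in>S. (a, b) \<in> E}}"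
        using A X by (intro card_mono) auto
      then show ?thesis using two_left[OF S True] by linarith
    next
      case False
      have "card {a\<in>X. 2 \<le> card {b\<in>S. (a, b) \<in> E}} \<le> card X"
        using X by (intro card_mono) auto
      then show ?thesis using X(3) False by linarith
    qed
  next
    fix S assume S: "S \<subseteq> X" "S \<noteq> {}"
    then have "card S \<le> s0" using card_mono[OF X(2) S(1)] X(3) by linarith
    then show "card {b\<in>B. 2 \<le> card {a\<in>S. (a, b) \<in> E}} \<le> 2 * card S"
      using S X by (intro two_right) auto
  next
    fix S T assume ST: "S \<subseteq> X" "T \<subseteq> B" "S \<noteq> {} \<or> T \<noteq> {}"
    show "(\<exists>a\<in>S. card {b\<in>T. (a, b) \<in> E} \<le> 2) \<or> (\<exists>b\<in>T. card {a\<in>S. (a, b) \<in> E} \<le> 2)"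
    proof (rule ccontr)
      assume "\<not> ?thesis"
      then have S3: "S \<subseteq> {a\<in>A. 3 \<le> card {b\<in>T. (a, b) \<in> E}}"
        and T3: "T \<subseteq> {b\<in>B. 3 \<le> card {a\<in>S. (a, b) \<in> E}}"
        using ST X by force+
      have S: "card S \<le> s0" using card_mono[OF X(2) ST(1)] X(3) by linarith
      have le: "card S \<le> card {a\<in>A. 3 \<le> card {b\<in>T. (a, b) \<in> E}}"
        "card T \<le> card {b\<in>B. 3 \<le> card {a\<in>S. (a, b) \<in> E}}"
        using S3 T3 A B by (auto intro: card_mono)
      have ne: "S \<noteq> {}" "T \<noteq> {}" using S3 T3 ST(3) by auto
      \<comment> \<open>If all degrees between \<open>S\<close> and \<open>T\<close> were at least
        3, each set would be smaller than the other. The order matters: \<open>S\<close> is small as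
        a set of exceptional vertices, and only \<open>card T < card S\<close> shows that
        \<open>T\<close> is small enough for \<open>three_left\<close>.\<close>
      have "card T < card S" using three_right[of S] S ne ST X le by fastforce
      moreover from this have "card S < card T" using three_left[of T] S ne ST le by fastforce
      ultimately show False by simp
    qed
  qed
  ultimately have un: "coverable E ((\<Union>i<q. U i \<times> Y i - E) \<union> (X \<times> B - E)) (card {..<q} * (2 * t) + 1156)"
    by (rule coverable_Un)
  have cov: "(a, b) \<in> (\<Union>i<q. U i \<times> Y i - E) \<union> (X \<times> B - E)"
    if ab: "a \<in> A" "b \<in> B" "(a, b) \<notin> E" for a b
  proof (cases "a \<in> X")
    case False
    obtain i where i: "i < q" "b \<in> Y i" using ab(2) unfolding Y by blast
    then have "a \<in> U i" using False ab(1) unfolding X_def U_def by (simp add: not_less) (meson not_le)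
    then show ?thesis using i ab by blast
  qed (use ab in blast)
  have "A \<times> B - E \<subseteq> (\<Union>i<q. U i \<times> Y i - E) \<union> (X \<times> B - E)" using cov by blast
  with un show ?thesis by (rule coverable_mono) simp
qed

section \<open>From coverings to realizers and back\<close>

lemma linear_order_on_key:
  fixes \<kappa> :: "'a \<Rightarrow> 'k::linorder"
  assumes "inj_on \<kappa> V"
  shows "linear_order_on V {(u, v). u \<in> V \<and> v \<in> V \<and> \<kappa> u \<le> \<kappa> v}"
  using assms unfolding linear_order_on_def partial_order_on_def preorder_on_def
    refl_on_def trans_def antisym_def total_on_def inj_on_def by fastforce

abbreviation (input) left_part :: "nat \<Rightarrow> nat set" where "left_part n \<equiv> {1..n}"
abbreviation (input) right_part :: "nat \<Rightarrow> nat set" where "right_part n \<equiv> {n+1..2*n}"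

text \<open>The \<open>+ 2\<close> pays for \<open>up\<close> and \<open>down\<close>, which both
  put the left part below the right part but list each part in opposite directions. Hence only pairs
  from left to right survive, and the covering sets remove the non-edges among them.\<close>

lemma realizer_of_coverable:
  assumes E: "E \<subseteq> left_part n \<times> right_part n"
    and cov: "coverable E (left_part n \<times> right_part n - E) k"
  shows "\<exists>L. finite L \<and> card L \<le> k + 2 \<and> (\<forall>l\<in>L. linear_order_on {1..2*n} l) \<and> \<Inter>L = bipartite_order n E"
proof -
  define V where "V = {1..2*n}"
  define ord where "ord \<kappa> = {(u, v). u \<in> V \<and> v \<in> V \<and> \<kappa> u \<le> \<kappa> v}" for \<kappa> :: "nat \<Rightarrow> int"
  obtain \<T> where T: "finite \<T>" "card \<T> \<le> k" "left_part n \<times> right_part n - E \<subseteq> \<Union>\<T>"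
    "\<And>T. T \<in> \<T> \<Longrightarrow> reversible E T" using cov unfolding coverable_def by blast
  define good where "good T \<kappa> \<longleftrightarrow> inj_on \<kappa> V \<and> (\<forall>(a, b)\<in>E. \<kappa> a < \<kappa> b) \<and>
    (\<forall>(a, b)\<in>T \<inter> left_part n \<times> right_part n. \<kappa> b < \<kappa> a)" for T and \<kappa> :: "nat \<Rightarrow> int"
  have ex: "\<exists>\<kappa>. good T \<kappa>" if "T \<in> \<T>" for T
  proof -
    have "reversible E T" by (rule T(4)[OF that])
    then obtain f g :: "nat \<Rightarrow> int" where fg: "\<forall>(a, b)\<in>E. f a < g b" "\<forall>(a, b)\<in>T. g b < f a"
      unfolding reversible_def by blast
    define h where "h v = (if v \<le> n then f v else g v)" for v
    \<comment> \<open>Heights may coincide. The factor \<open>2 * n + 1\<close> exceeds every vertex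
      number, so adding the vertex breaks ties without disturbing strict inequalities.\<close>
    define \<kappa> where "\<kappa> v = h v * (2 * int n + 1) + int v" for v
    have less: "\<kappa> u < \<kappa> v" if "h u < h v" "u \<in> V" for u v
    proof -
      have "(h u + 1) * (2 * int n + 1) \<le> h v * (2 * int n + 1)"
        using that by (intro mult_right_mono) auto
      then show ?thesis using that by (auto simp: \<kappa>_def V_def algebra_simps)
    qed
    have "inj_on \<kappa> V"
    proof (rule inj_onI)
      fix u v assume "u \<in> V" "v \<in> V" "\<kappa> u = \<kappa> v"
      then have "h u = h v" using less[of u v] less[of v u] by fastforce
      then show "u = v" using \<open>\<kappa> u = \<kappa> v\<close> by (simp add: \<kappa>_def)
    qed
    moreover have "\<kappa> a < \<kappa> b" if "(a, b) \<in> E" for a b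
      using bspec[OF fg(1) that] that E by (intro less) (auto simp: h_def V_def)
    moreover have "\<kappa> b < \<kappa> a" if "(a, b) \<in> T" "a \<in> left_part n" "b \<in> right_part n" for a b
      using bspec[OF fg(2) that(1)] that by (intro less) (auto simp: h_def V_def)
    ultimately show ?thesis unfolding good_def by (intro exI[of _ \<kappa>]) auto
  qed
  then have "\<forall>T\<in>\<T>. \<exists>\<kappa>. good T \<kappa>" by blast
  from bchoice[OF this] obtain K where K0: "\<forall>T\<in>\<T>. good T (K T)" by blast
  have K: "inj_on (K T) V" "(a, b) \<in> E \<Longrightarrow> K T a < K T b"
    "(a, b) \<in> T \<Longrightarrow> a \<in> left_part n \<Longrightarrow> b \<in> right_part n \<Longrightarrow> K T b < K T a" if "T \<in> \<T>" for T a b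
    using bspec[OF K0 that] unfolding good_def by auto
  define up where "up v = int v" for v :: nat
  define down where "down v = (if v \<le> n then - int v else 3 * int n - int v)" for v :: nat
  define L where "L = {ord up, ord down} \<union> (\<lambda>T. ord (K T)) ` \<T>"
  have fin: "finite L" using T(1) by (simp add: L_def)
  have "card L \<le> card {ord up, ord down} + card ((\<lambda>T. ord (K T)) ` \<T>)"
    unfolding L_def by (rule card_Un_le)
  also have "\<dots> \<le> 2 + k"
    using card_image_le[OF T(1), of "\<lambda>T. ord (K T)"] T(2)
      card_insert_le_m1[of 2 "{ord down}" "ord up"] by simp
  finally have card: "card L \<le> k + 2" by simp
  have inj: "inj_on up V" "inj_on down V"
    by (auto simp: up_def down_def V_def inj_on_def split: if_splits)
  have lin: "linear_order_on V l" if "l \<in> L" for l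
    using that inj K(1) linear_order_on_key[of _ V] unfolding L_def ord_def by auto
  have "\<Inter>L = bipartite_order n E"
  proof (intro set_eqI iffI)
    fix z assume z: "z \<in> \<Inter>L"
    obtain u v where uv: "z = (u, v)" by (cases z)
    have 1: "(u, v) \<in> ord up" "(u, v) \<in> ord down" using z by (auto simp: uv L_def)
    then have V: "u \<in> {1..2*n}" "v \<in> {1..2*n}" by (auto simp: ord_def V_def)
    show "z \<in> bipartite_order n E"
    proof (cases "u = v")
      case True
      then show ?thesis using V by (auto simp: uv bipartite_order_def Id_on_iff)
    next
      case False
      have ab: "u \<in> left_part n" "v \<in> right_part n"
        using 1 V False by (auto simp: ord_def up_def down_def split: if_splits)
      have "(u, v) \<in> E"
      proof (rule ccontr)
        assume "(u, v) \<notin> E"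
        then obtain T' where T': "T' \<in> \<T>" "(u, v) \<in> T'" using T(3) ab by blast
        have "(u, v) \<in> ord (K T')" using z T' by (auto simp: uv L_def)
        then show False using K(3)[OF T' ab] by (simp add: ord_def)
      qed
      then show ?thesis using ab by (simp add: uv bipartite_order_def)
    qed
  next
    fix z assume "z \<in> bipartite_order n E"
    then consider u where "z = (u, u)" "u \<in> V"
      | u v where "z = (u, v)" "u \<in> left_part n" "v \<in> right_part n" "(u, v) \<in> E"
      by (auto simp: bipartite_order_def V_def)
    then show "z \<in> \<Inter>L"
    proof cases
      case 1
      then show ?thesis by (auto simp: L_def ord_def)
    next
      case (2 u v)
      have "u \<in> V" "v \<in> V" using 2 by (auto simp: V_def)
      moreover have "K T' u \<le> K T' v" if "T' \<in> \<T>" for T' using K(2)[OF that 2(4)] by simp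
      ultimately show ?thesis using 2 by (auto simp: L_def ord_def up_def down_def)
    qed
  qed
  then show ?thesis using fin card lin unfolding V_def by blast
qed

lemma bipartite_dim_le:
  assumes "E \<subseteq> left_part n \<times> right_part n" "coverable E (left_part n \<times> right_part n - E) k"
  shows "bipartite_dim n E \<le> k + 2"
proof -
  obtain L where L: "finite L" "card L \<le> k + 2" "\<forall>l\<in>L. linear_order_on {1..2*n} l"
    "\<Inter>L = bipartite_order n E" using realizer_of_coverable[OF assms] by blast
  have "bipartite_dim n E \<le> card L"
    unfolding bipartite_dim_def poset_dim_def by (rule Least_le) (use L in blast)
  then show ?thesis using L by simp
qed

lemma bipartite_dim_realizer:
  assumes "E \<subseteq> left_part n \<times> right_part n"
  obtains L where "finite L" "card L = bipartite_dim n E" "\<forall>l\<in>L. linear_order_on {1..2*n} l"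
    "\<Inter>L = bipartite_order n E"
proof -
  have "\<exists>d L. finite L \<and> card L = d \<and> (\<forall>l\<in>L. linear_order_on {1..2*n} l) \<and> \<Inter>L = bipartite_order n E"
    using realizer_of_coverable[OF assms coverable_finite] by blast
  from LeastI_ex[OF this] show ?thesis
    unfolding poset_dim_def[symmetric] bipartite_dim_def[symmetric] using that by (elim exE conjE)
qed

text \<open>The two halves of \<open>2 * k * n\<close>: in each order fewer than \<open>k\<close>
  left vertices lie above \<open>k\<close> or more right vertices, and each of them reverses at most
  \<open>n\<close> pairs; every other left vertex reverses fewer than \<open>k\<close>.\<close>

lemma area_le_dim:
  assumes E: "E \<subseteq> left_part n \<times> right_part n"
    and hole: "\<And>S T. S \<subseteq> left_part n \<Longrightarrow> T \<subseteq> right_part n \<Longrightarrow> card S = k \<Longrightarrow> card T = k \<Longrightarrow> S \<times> T \<inter> E \<noteq> {}"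
  shows "n * n \<le> card E + bipartite_dim n E * (2 * k * n)"
proof -
  obtain L where L: "finite L" "card L = bipartite_dim n E"
    "\<forall>l\<in>L. linear_order_on {1..2*n} l" "\<Inter>L = bipartite_order n E"
    using bipartite_dim_realizer[OF E] by blast
  define R where "R l = {(a, b). a \<in> left_part n \<and> b \<in> right_part n \<and> (b, a) \<in> l}" for l
  have finR: "finite (R l)" for l
    by (rule finite_subset[of _ "left_part n \<times> right_part n"]) (auto simp: R_def)
  have cardR: "card (R l) \<le> 2 * k * n" if l: "l \<in> L" for l
  proof -
    have lin: "linear_order_on {1..2*n} l" using L(3) l by blast
    have tr: "trans l" and tot: "total_on {1..2*n} l" and anti: "antisym l" and refl: "refl_on {1..2*n} l"
      using lin by (auto simp: linear_order_on_def partial_order_on_def preorder_on_def)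
    define D where "D a = {b\<in>right_part n. (b, a) \<in> l}" for a
    define Big where "Big = {a\<in>left_part n. k \<le> card (D a)}"
    have finD: "finite (D a)" for a by (simp add: D_def)
    have chain: "D a \<subseteq> D a' \<or> D a' \<subseteq> D a" if "a \<in> left_part n" "a' \<in> left_part n" for a a'
    proof -
      have "(a, a') \<in> l \<or> (a', a) \<in> l"
        using tot refl that by (cases "a = a'") (auto simp: total_on_def refl_on_def)
      then show ?thesis using tr unfolding D_def by (blast dest: transD)
    qed
    have "card Big < k \<or> k = 0"
    proof (rule ccontr)
      assume "\<not> ?thesis"
      then have big: "k \<le> card Big" "0 < k" by auto
      then have "Big \<noteq> {}" by auto
      moreover have "finite Big" by (simp add: Big_def)
      \<comment> \<open>As the sets \<open>D a\<close> form a chain, the one of least size lies in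
        all others, so any \<open>k\<close> of its elements are below all of \<open>Big\<close> and
        span an empty rectangle with it.\<close>
      ultimately obtain a where a: "a \<in> Big" "\<And>a'. a' \<in> Big \<Longrightarrow> card (D a) \<le> card (D a')"
        using ex_min_if_finite[of "(\<lambda>a. card (D a)) ` Big"] by (auto simp: not_less)
      have sub: "D a \<subseteq> D a'" if "a' \<in> Big" for a'
      proof -
        have "a \<in> left_part n" "a' \<in> left_part n" using that a by (auto simp: Big_def)
        from chain[OF this] show ?thesis
          using a(2)[OF that] card_seteq[OF finD, of "D a'" a] by auto
      qed
      obtain S where S: "S \<subseteq> Big" "card S = k" using obtain_subset_with_card_n[OF big(1)] by blast
      obtain T where T: "T \<subseteq> D a" "card T = k"
        using obtain_subset_with_card_n[of k "D a"] a(1) by (auto simp: Big_def)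
      have "S \<times> T \<inter> E \<noteq> {}"
        by (rule hole) (use S T in \<open>auto simp: Big_def D_def\<close>)
      then obtain x y where xy: "x \<in> S" "y \<in> T" "(x, y) \<in> E" by blast
      have "(y, x) \<in> l" using xy S T sub[of x] by (auto simp: D_def)
      moreover have "(x, y) \<in> l"
      proof -
        have "(x, y) \<in> bipartite_order n E" using xy E by (auto simp: bipartite_order_def)
        then show ?thesis using L(4) l by blast
      qed
      ultimately have "x = y" using anti by (auto dest: antisymD)
      then show False using xy E by auto
    qed
    \<comment> \<open>For \<open>k = 0\<close> the assumption on rectangles is contradictory, as
      witnessed by the empty one.\<close>
    moreover have False if "k = 0"
      using hole[of "{}" "{}"] that by auto
    ultimately have small: "card Big < k" by blast
    have "R l \<subseteq> Big \<times> right_part n \<union> (SIGMA a:left_part n - Big. D a)"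
      by (auto simp: R_def Big_def D_def)
    then have "card (R l) \<le> card (Big \<times> right_part n \<union> (SIGMA a:left_part n - Big. D a))"
      by (intro card_mono) (auto simp: Big_def D_def)
    also have "\<dots> \<le> card (Big \<times> right_part n) + card (SIGMA a:left_part n - Big. D a)"
      by (rule card_Un_le)
    also have "card (Big \<times> right_part n) \<le> k * n"
      using small by (simp add: card_cartesian_product)
    also have "card (SIGMA a:left_part n - Big. D a) = (\<Sum>a\<in>left_part n - Big. card (D a))"
      by (rule card_SigmaI) (auto simp: finD)
    also have "\<dots> \<le> (\<Sum>a\<in>left_part n - Big. k)"
      by (rule sum_mono) (auto simp: Big_def)
    also have "\<dots> \<le> n * k"
      using card_mono[of "left_part n" "left_part n - Big"] by simp
    finally show ?thesis by (simp add: mult_ac)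
  qed
  have "left_part n \<times> right_part n \<subseteq> E \<union> (\<Union>l\<in>L. R l)"
  proof clarify
    fix a b assume ab: "a \<in> left_part n" "b \<in> right_part n" "(a, b) \<notin> (\<Union>l\<in>L. R l)"
    have "(a, b) \<in> l" if "l \<in> L" for l
    proof -
      have "(b, a) \<notin> l" using ab that by (auto simp: R_def)
      moreover have "a \<in> {1..2*n}" "b \<in> {1..2*n}" "a \<noteq> b" using ab by auto
      ultimately show ?thesis
        using bspec[OF L(3) that] unfolding linear_order_on_def total_on_def by blast
    qed
    then have "(a, b) \<in> bipartite_order n E" using L(4) by blast
    then show "(a, b) \<in> E" using ab by (auto simp: bipartite_order_def)
  qed
  then have "card (left_part n \<times> right_part n) \<le> card (E \<union> (\<Union>l\<in>L. R l))"
    using finR L(1) E finite_subset[OF E] by (intro card_mono) auto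
  also have "\<dots> \<le> card E + card (\<Union>l\<in>L. R l)" by (rule card_Un_le)
  also have "card (\<Union>l\<in>L. R l) \<le> (\<Sum>l\<in>L. card (R l))" by (rule card_UN_le[OF L(1)])
  also have "\<dots> \<le> card L * (2 * k * n)" using sum_bounded_above[of L "\<lambda>l. card (R l)" "2 * k * n"] cardR by simp
  finally show ?thesis by (simp add: card_cartesian_product L(2))
qed

section \<open>Random bipartite graphs\<close>

lemma random_bipartite_subset:
  assumes "E \<in> set_pmf (random_bipartite n p)"
  shows "E \<subseteq> left_part n \<times> right_part n"
proof -
  obtain f where f: "E = {e. f e}" "f \<in> set_pmf (Pi_pmf (left_part n \<times> right_part n) False (\<lambda>_. bernoulli_pmf p))"
    using assms by (auto simp: random_bipartite_def)
  have fin: "finite (left_part n \<times> right_part n)" by simp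
  have "\<forall>e. e \<notin> left_part n \<times> right_part n \<longrightarrow> f e = False"
    using subsetD[OF set_Pi_pmf_subset[OF fin] f(2)] by simp
  then show ?thesis using f(1) by blast
qed

lemma prob_superset:
  assumes F: "F \<subseteq> left_part n \<times> right_part n" and p: "0 \<le> p" "p \<le> 1"
  shows "measure_pmf.prob (random_bipartite n p) {E. F \<subseteq> E} = p ^ card F"
proof -
  define \<Omega> where "\<Omega> = left_part n \<times> right_part n"
  have "(\<lambda>f. {e. f e}) -` {E. F \<subseteq> E} = Pi \<Omega> (\<lambda>e. if e \<in> F then {True} else UNIV)"
    using F by (auto simp: \<Omega>_def Pi_def split: if_splits)
  then have "measure_pmf.prob (random_bipartite n p) {E. F \<subseteq> E}
      = (\<Prod>e\<in>\<Omega>. measure_pmf.prob (bernoulli_pmf p) (if e \<in> F then {True} else UNIV))"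
    unfolding random_bipartite_def \<Omega>_def[symmetric] measure_map_pmf
    by (simp add: measure_Pi_pmf_Pi \<Omega>_def)
  also have "\<dots> = (\<Prod>e\<in>\<Omega>. if e \<in> F then p else 1)"
    using p by (intro prod.cong) (auto simp: measure_pmf_single)
  also have "\<dots> = p ^ card F"
    using F by (subst prod.inter_restrict[symmetric]) (auto simp: \<Omega>_def Int_absorb1)
  finally show ?thesis .
qed

lemma prob_disjoint:
  assumes F: "F \<subseteq> left_part n \<times> right_part n" and p: "0 \<le> p" "p \<le> 1"
  shows "measure_pmf.prob (random_bipartite n p) {E. F \<inter> E = {}} = (1 - p) ^ card F"
proof -
  define \<Omega> where "\<Omega> = left_part n \<times> right_part n"
  have "(\<lambda>f. {e. f e}) -` {E. F \<inter> E = {}} = Pi \<Omega> (\<lambda>e. if e \<in> F then {False} else UNIV)"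
    using F by (auto simp: \<Omega>_def Pi_def split: if_splits)
  then have "measure_pmf.prob (random_bipartite n p) {E. F \<inter> E = {}}
      = (\<Prod>e\<in>\<Omega>. measure_pmf.prob (bernoulli_pmf p) (if e \<in> F then {False} else UNIV))"
    unfolding random_bipartite_def \<Omega>_def[symmetric] measure_map_pmf
    by (simp add: measure_Pi_pmf_Pi \<Omega>_def)
  also have "\<dots> = (\<Prod>e\<in>\<Omega>. if e \<in> F then 1 - p else 1)"
    using p by (intro prod.cong) (auto simp: measure_pmf_single)
  also have "\<dots> = (1 - p) ^ card F"
    using F by (subst prod.inter_restrict[symmetric]) (auto simp: \<Omega>_def Int_absorb1)
  finally show ?thesis .
qed

section \<open>First-moment bounds\<close>

lemma prob_UN_le:
  fixes M :: "'a pmf"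
  assumes "finite I" "X \<subseteq> (\<Union>i\<in>I. Y i)" "\<And>i. i \<in> I \<Longrightarrow> measure_pmf.prob M (Y i) \<le> c"
  shows "measure_pmf.prob M X \<le> real (card I) * c"
proof -
  have "measure_pmf.prob M X \<le> measure_pmf.prob M (\<Union>i\<in>I. Y i)"
    by (rule measure_pmf.finite_measure_mono[OF assms(2)]) simp
  also have "\<dots> \<le> (\<Sum>i\<in>I. measure_pmf.prob M (Y i))"
    by (rule measure_pmf.finite_measure_subadditive_finite[OF assms(1)]) simp
  also have "\<dots> \<le> real (card I) * c" using assms(3) by (intro sum_bounded_above) auto
  finally show ?thesis .
qed

text \<open>The map \<open>e\<close> stands for either of the two ways of turning a pair of vertices into an edge.\<close>

lemma prob_stars:
  fixes e :: "'a \<Rightarrow> 'b \<Rightarrow> nat \<times> nat"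
  assumes p: "0 \<le> p" "p \<le> 1"
    and fin: "finite T" "finite \<R>" "finite W"
    and R: "\<And>R. R \<in> \<R> \<Longrightarrow> R \<subseteq> W \<and> card R = j"
    and inj: "inj_on (\<lambda>(a, b). e a b) (T \<times> W)"
    and ran: "\<And>a b. a \<in> T \<Longrightarrow> b \<in> W \<Longrightarrow> e a b \<in> left_part n \<times> right_part n"
  shows "measure_pmf.prob (random_bipartite n p) {E. \<forall>a\<in>T. \<exists>R\<in>\<R>. \<forall>b\<in>R. e a b \<in> E}
    \<le> (real (card \<R>) * p ^ j) ^ card T"
proof -
  define F where "F \<phi> = (\<lambda>(a, b). e a b) ` (SIGMA a:T. \<phi> a)" for \<phi> :: "'a \<Rightarrow> 'b set"
  have "measure_pmf.prob (random_bipartite n p) {E. \<forall>a\<in>T. \<exists>R\<in>\<R>. \<forall>b\<in>R. e a b \<in> E}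
      \<le> real (card (T \<rightarrow>\<^sub>E \<R>)) * p ^ (j * card T)"
  proof (rule prob_UN_le[where Y = "\<lambda>\<phi>. {E. F \<phi> \<subseteq> E}"])
    show "finite (T \<rightarrow>\<^sub>E \<R>)" using fin by (intro finite_PiE) auto
    show "{E. \<forall>a\<in>T. \<exists>R\<in>\<R>. \<forall>b\<in>R. e a b \<in> E} \<subseteq> (\<Union>\<phi>\<in>T \<rightarrow>\<^sub>E \<R>. {E. F \<phi> \<subseteq> E})"
    proof
      fix E assume "E \<in> {E. \<forall>a\<in>T. \<exists>R\<in>\<R>. \<forall>b\<in>R. e a b \<in> E}"
      then have "\<forall>a\<in>T. \<exists>R. R \<in> \<R> \<and> (\<forall>b\<in>R. e a b \<in> E)" by blast
      from bchoice[OF this] obtain f where f: "\<forall>a\<in>T. f a \<in> \<R> \<and> (\<forall>b\<in>f a. e a b \<in> E)" by blast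
      then have "restrict f T \<in> T \<rightarrow>\<^sub>E \<R>" "F (restrict f T) \<subseteq> E" by (auto simp: F_def)
      then show "E \<in> (\<Union>\<phi>\<in>T \<rightarrow>\<^sub>E \<R>. {E. F \<phi> \<subseteq> E})" by blast
    qed
    fix \<phi> assume \<phi>: "\<phi> \<in> T \<rightarrow>\<^sub>E \<R>"
    have mem: "\<phi> a \<subseteq> W" "card (\<phi> a) = j" if "a \<in> T" for a using R PiE_mem[OF \<phi> that] by auto
    have "card (F \<phi>) = card (SIGMA a:T. \<phi> a)"
      unfolding F_def using mem by (intro card_image inj_on_subset[OF inj]) auto
    also have "\<dots> = (\<Sum>a\<in>T. card (\<phi> a))"
      using fin mem finite_subset[OF _ fin(3)] by (intro card_SigmaI) auto
    also have "\<dots> = j * card T" using mem by simp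
    finally have "card (F \<phi>) = j * card T" .
    moreover have "F \<phi> \<subseteq> left_part n \<times> right_part n"
    proof
      fix x assume "x \<in> F \<phi>"
      then obtain a b where "a \<in> T" "b \<in> \<phi> a" "x = e a b" by (auto simp: F_def)
      then show "x \<in> left_part n \<times> right_part n" using ran[of a b] mem(1)[of a] by blast
    qed
    ultimately show "measure_pmf.prob (random_bipartite n p) {E. F \<phi> \<subseteq> E} \<le> p ^ (j * card T)"
      using prob_superset[OF _ p] by simp
  qed
  also have "\<dots> = (real (card \<R>) * p ^ j) ^ card T"
    using fin(1) by (simp add: card_PiE power_mult_distrib power_mult)
  finally show ?thesis .
qed

text \<open>The union runs over \<open>S\<close> and over \<open>m\<close> vertices that each choose
  \<open>j\<close> neighbours in \<open>S\<close>. Stars at different vertices share no edge, so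
  their probabilities multiply.\<close>

lemma prob_crowded:
  fixes e :: "'a \<Rightarrow> 'b \<Rightarrow> nat \<times> nat"
  assumes p: "0 \<le> p" "p \<le> 1"
    and A: "finite A" "card A = n" and B: "finite B" "card B = n"
    and inj: "inj_on (\<lambda>(a, b). e a b) (A \<times> B)"
    and ran: "\<And>a b. a \<in> A \<Longrightarrow> b \<in> B \<Longrightarrow> e a b \<in> left_part n \<times> right_part n"
  shows "measure_pmf.prob (random_bipartite n p)
      {E. \<exists>S\<subseteq>B. card S = s \<and> m \<le> card {a\<in>A. j \<le> card {b\<in>S. e a b \<in> E}}}
    \<le> real (n choose s) * real (n choose m) * (real (s choose j) * p ^ j) ^ m"
proof -
  define \<S> where "\<S> = {S. S \<subseteq> B \<and> card S = s}"
  define \<T> where "\<T> = {T. T \<subseteq> A \<and> card T = m}"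
  have "measure_pmf.prob (random_bipartite n p)
      {E. \<exists>S\<subseteq>B. card S = s \<and> m \<le> card {a\<in>A. j \<le> card {b\<in>S. e a b \<in> E}}}
    \<le> real (card (\<S> \<times> \<T>)) * (real (s choose j) * p ^ j) ^ m"
  proof (rule prob_UN_le[where Y = "\<lambda>(S, T). {E. \<forall>a\<in>T. \<exists>R\<in>{R. R \<subseteq> S \<and> card R = j}. \<forall>b\<in>R. e a b \<in> E}"])
    show "finite (\<S> \<times> \<T>)" using A B by (auto simp: \<S>_def \<T>_def)
    show "{E. \<exists>S\<subseteq>B. card S = s \<and> m \<le> card {a\<in>A. j \<le> card {b\<in>S. e a b \<in> E}}}
      \<subseteq> (\<Union>z\<in>\<S> \<times> \<T>. case z of (S, T) \<Rightarrow> {E. \<forall>a\<in>T. \<exists>R\<in>{R. R \<subseteq> S \<and> card R = j}. \<forall>b\<in>R. e a b \<in> E})"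
    proof
      fix E assume "E \<in> {E. \<exists>S\<subseteq>B. card S = s \<and> m \<le> card {a\<in>A. j \<le> card {b\<in>S. e a b \<in> E}}}"
      then obtain S where S: "S \<subseteq> B" "card S = s" "m \<le> card {a\<in>A. j \<le> card {b\<in>S. e a b \<in> E}}"
        by blast
      obtain T where T: "T \<subseteq> {a\<in>A. j \<le> card {b\<in>S. e a b \<in> E}}" "card T = m"
        using obtain_subset_with_card_n[OF S(3)] by blast
      have "\<exists>R\<in>{R. R \<subseteq> S \<and> card R = j}. \<forall>b\<in>R. e a b \<in> E" if "a \<in> T" for a
      proof -
        have card: "j \<le> card {b\<in>S. e a b \<in> E}" using T that by blast
        obtain R where "R \<subseteq> {b\<in>S. e a b \<in> E}" "card R = j"
          using obtain_subset_with_card_n[OF card] by blast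
        then show ?thesis by blast
      qed
      moreover have "(S, T) \<in> \<S> \<times> \<T>" using S T by (auto simp: \<S>_def \<T>_def)
      ultimately show "E \<in> (\<Union>z\<in>\<S> \<times> \<T>. case z of (S, T) \<Rightarrow>
          {E. \<forall>a\<in>T. \<exists>R\<in>{R. R \<subseteq> S \<and> card R = j}. \<forall>b\<in>R. e a b \<in> E})" by blast
    qed
    fix z assume "z \<in> \<S> \<times> \<T>"
    then obtain S T where z: "z = (S, T)" "S \<subseteq> B" "card S = s" "T \<subseteq> A" "card T = m"
      by (auto simp: \<S>_def \<T>_def)
    have fS: "finite S" "finite T" using z A B finite_subset by auto
    have "measure_pmf.prob (random_bipartite n p)
        {E. \<forall>a\<in>T. \<exists>R\<in>{R. R \<subseteq> S \<and> card R = j}. \<forall>b\<in>R. e a b \<in> E}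
      \<le> (real (card {R. R \<subseteq> S \<and> card R = j}) * p ^ j) ^ card T"
      by (rule prob_stars[OF p, where W = S])
        (use fS z ran in \<open>auto intro: inj_on_subset[OF inj]\<close>)
    then show "measure_pmf.prob (random_bipartite n p)
        (case z of (S, T) \<Rightarrow> {E. \<forall>a\<in>T. \<exists>R\<in>{R. R \<subseteq> S \<and> card R = j}. \<forall>b\<in>R. e a b \<in> E})
      \<le> (real (s choose j) * p ^ j) ^ m"
      using fS z by (simp add: n_subsets)
  qed
  then show ?thesis using A B by (simp add: card_cartesian_product n_subsets \<S>_def \<T>_def)
qed

text \<open>An exceptional vertex carries a star with \<open>r + 1\<close> leaves in a single block.
  Different vertices may use different blocks, so the factor \<open>q\<close> stands inside the
  power.\<close>

lemma prob_exceptional: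
  assumes p: "0 \<le> p" "p \<le> 1"
    and Y: "\<And>i. i < q \<Longrightarrow> Y i \<subseteq> right_part n \<and> card (Y i) \<le> y"
  shows "measure_pmf.prob (random_bipartite n p)
      {E. s \<le> card {a\<in>left_part n. \<exists>i<q. r < card {b\<in>Y i. (a, b) \<in> E}}}
    \<le> real (n choose s) * (real q * real (y choose (r + 1)) * p ^ (r + 1)) ^ s"
proof -
  define \<R> where "\<R> = (\<Union>i<q. {R. R \<subseteq> Y i \<and> card R = r + 1})"
  have fY: "finite (Y i)" if "i < q" for i using Y[OF that] finite_subset by blast
  have f\<R>: "finite \<R>" unfolding \<R>_def using fY by auto
  have "card \<R> \<le> (\<Sum>i<q. card {R. R \<subseteq> Y i \<and> card R = r + 1})"
    unfolding \<R>_def by (rule card_UN_le) simp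
  also have "\<dots> \<le> (\<Sum>i<q. y choose (r + 1))"
    using fY Y by (intro sum_mono) (auto simp: n_subsets intro: binomial_right_mono)
  finally have card\<R>: "real (card \<R>) \<le> real q * real (y choose (r + 1))"
    by (simp flip: of_nat_mult)
  have "measure_pmf.prob (random_bipartite n p)
      {E. s \<le> card {a\<in>left_part n. \<exists>i<q. r < card {b\<in>Y i. (a, b) \<in> E}}}
    \<le> real (card {T. T \<subseteq> left_part n \<and> card T = s}) * (real q * real (y choose (r + 1)) * p ^ (r + 1)) ^ s"
  proof (rule prob_UN_le[where Y = "\<lambda>T. {E. \<forall>a\<in>T. \<exists>R\<in>\<R>. \<forall>b\<in>R. (a, b) \<in> E}"])
    show "finite {T. T \<subseteq> left_part n \<and> card T = s}" by simp
    show "{E. s \<le> card {a\<in>left_part n. \<exists>i<q. r < card {b\<in>Y i. (a, b) \<in> E}}}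
      \<subseteq> (\<Union>T\<in>{T. T \<subseteq> left_part n \<and> card T = s}. {E. \<forall>a\<in>T. \<exists>R\<in>\<R>. \<forall>b\<in>R. (a, b) \<in> E})"
    proof
      fix E assume "E \<in> {E. s \<le> card {a\<in>left_part n. \<exists>i<q. r < card {b\<in>Y i. (a, b) \<in> E}}}"
      then obtain T where T: "T \<subseteq> {a\<in>left_part n. \<exists>i<q. r < card {b\<in>Y i. (a, b) \<in> E}}" "card T = s"
        using obtain_subset_with_card_n by blast
      have "\<exists>R\<in>\<R>. \<forall>b\<in>R. (a, b) \<in> E" if "a \<in> T" for a
      proof -
        have "a \<in> {a\<in>left_part n. \<exists>i<q. r < card {b\<in>Y i. (a, b) \<in> E}}" using T that by blast
        then obtain i where i: "i < q" "r + 1 \<le> card {b\<in>Y i. (a, b) \<in> E}" by auto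
        obtain R where "R \<subseteq> {b\<in>Y i. (a, b) \<in> E}" "card R = r + 1"
          using obtain_subset_with_card_n[OF i(2)] by blast
        then show ?thesis using i(1) unfolding \<R>_def by blast
      qed
      then show "E \<in> (\<Union>T\<in>{T. T \<subseteq> left_part n \<and> card T = s}. {E. \<forall>a\<in>T. \<exists>R\<in>\<R>. \<forall>b\<in>R. (a, b) \<in> E})"
        using T by blast
    qed
    fix T assume "T \<in> {T. T \<subseteq> left_part n \<and> card T = s}"
    then have T: "T \<subseteq> left_part n" "card T = s" by auto
    have "measure_pmf.prob (random_bipartite n p) {E. \<forall>a\<in>T. \<exists>R\<in>\<R>. \<forall>b\<in>R. (a, b) \<in> E}
      \<le> (real (card \<R>) * p ^ (r + 1)) ^ card T"
    proof (rule prob_stars[OF p, where W = "right_part n"])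
      show "finite T" using T finite_subset by blast
      show "R \<subseteq> right_part n \<and> card R = r + 1" if "R \<in> \<R>" for R
        using that Y unfolding \<R>_def by blast
    qed (use f\<R> T in \<open>auto simp: inj_on_def\<close>)
    also have "\<dots> \<le> (real q * real (y choose (r + 1)) * p ^ (r + 1)) ^ card T"
      using card\<R> p by (intro power_mono mult_right_mono) auto
    finally show "measure_pmf.prob (random_bipartite n p) {E. \<forall>a\<in>T. \<exists>R\<in>\<R>. \<forall>b\<in>R. (a, b) \<in> E}
      \<le> (real q * real (y choose (r + 1)) * p ^ (r + 1)) ^ s" using T by simp
  qed
  then show ?thesis by (simp add: n_subsets)
qed

lemma prob_hole:
  assumes p: "0 \<le> p" "p \<le> 1"
  shows "measure_pmf.prob (random_bipartite n p)
      {E. \<exists>S T. S \<subseteq> left_part n \<and> T \<subseteq> right_part n \<and> card S = k \<and> card T = k \<and> S \<times> T \<inter> E = {}}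
    \<le> real (n choose k) * real (n choose k) * (1 - p) ^ (k * k)"
proof -
  define I where "I = {S. S \<subseteq> left_part n \<and> card S = k} \<times> {T. T \<subseteq> right_part n \<and> card T = k}"
  have "measure_pmf.prob (random_bipartite n p)
      {E. \<exists>S T. S \<subseteq> left_part n \<and> T \<subseteq> right_part n \<and> card S = k \<and> card T = k \<and> S \<times> T \<inter> E = {}}
    \<le> real (card I) * (1 - p) ^ (k * k)"
  proof (rule prob_UN_le[where Y = "\<lambda>(S, T). {E. S \<times> T \<inter> E = {}}"])
    fix z assume "z \<in> I"
    then obtain S T where z: "z = (S, T)" "S \<subseteq> left_part n" "T \<subseteq> right_part n" "card S = k" "card T = k"
      by (auto simp: I_def)
    then have "S \<times> T \<subseteq> left_part n \<times> right_part n" by blast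
    from prob_disjoint[OF this p] z show "measure_pmf.prob (random_bipartite n p)
        (case z of (S, T) \<Rightarrow> {E. S \<times> T \<inter> E = {}}) \<le> (1 - p) ^ (k * k)"
      by (simp add: card_cartesian_product)
  next
    show "finite I" by (simp add: I_def)
    show "{E. \<exists>S T. S \<subseteq> left_part n \<and> T \<subseteq> right_part n \<and> card S = k \<and> card T = k \<and> S \<times> T \<inter> E = {}}
        \<subseteq> (\<Union>z\<in>I. case z of (S, T) \<Rightarrow> {E. S \<times> T \<inter> E = {}})"
    proof
      fix E assume "E \<in> {E. \<exists>S T. S \<subseteq> left_part n \<and> T \<subseteq> right_part n \<and> card S = k \<and> card T = k \<and> S \<times> T \<inter> E = {}}"
      then obtain S T where ST: "(S, T) \<in> I" "S \<times> T \<inter> E = {}" unfolding I_def by blast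
      show "E \<in> (\<Union>z\<in>I. case z of (S, T) \<Rightarrow> {E. S \<times> T \<inter> E = {}})"
        by (rule UN_I[OF ST(1)]) (simp add: ST(2))
    qed
  qed
  then show ?thesis by (simp add: I_def card_cartesian_product n_subsets)
qed

lemma prob_edges:
  assumes p: "0 \<le> p" "p \<le> 1"
  shows "measure_pmf.prob (random_bipartite n p) {E. m \<le> card (E \<inter> left_part n \<times> right_part n)}
    \<le> real ((n * n) choose m) * p ^ m"
proof -
  define I where "I = {F. F \<subseteq> left_part n \<times> right_part n \<and> card F = m}"
  have "measure_pmf.prob (random_bipartite n p) {E. m \<le> card (E \<inter> left_part n \<times> right_part n)}
    \<le> real (card I) * p ^ m"
  proof (rule prob_UN_le[where Y = "\<lambda>F. {E. F \<subseteq> E}"])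
    show "{E. m \<le> card (E \<inter> left_part n \<times> right_part n)} \<subseteq> (\<Union>F\<in>I. {E. F \<subseteq> E})"
    proof
      fix E assume "E \<in> {E. m \<le> card (E \<inter> left_part n \<times> right_part n)}"
      then obtain F where "F \<subseteq> E \<inter> left_part n \<times> right_part n" "card F = m"
        using obtain_subset_with_card_n by blast
      then show "E \<in> (\<Union>F\<in>I. {E. F \<subseteq> E})" unfolding I_def by blast
    qed
    show "finite I" by (simp add: I_def)
    show "measure_pmf.prob (random_bipartite n p) {E. F \<subseteq> E} \<le> p ^ m" if "F \<in> I" for F
      using prob_superset[OF _ p, of F n] that by (simp add: I_def)
  qed
  then show ?thesis by (simp add: I_def n_subsets card_cartesian_product)
qed

section \<open>Rules for asymptotically almost sure events\<close>

lemma aas_if_prob_le: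
  assumes "\<forall>\<^sub>F n in sequentially. measure_pmf.prob (M n) {x. \<not> Q n x} \<le> \<delta> n" "\<delta> \<longlonglongrightarrow> 0"
  shows "aas M Q"
proof -
  have eq: "measure_pmf.prob (M n) {x. Q n x} = 1 - measure_pmf.prob (M n) {x. \<not> Q n x}" for n
    using measure_pmf.prob_compl[of "{x. Q n x}" "M n"] by (simp add: Collect_neg_eq Compl_eq_Diff_UNIV)
  have "(\<lambda>n. measure_pmf.prob (M n) {x. \<not> Q n x}) \<longlonglongrightarrow> 0"
    by (rule tendsto_sandwich[OF _ assms(1) tendsto_const assms(2)]) simp
  from tendsto_diff[OF tendsto_const[of 1] this] show ?thesis unfolding aas_def eq by simp
qed

lemma aas_imp_prob: "aas M Q \<Longrightarrow> (\<lambda>n. measure_pmf.prob (M n) {x. \<not> Q n x}) \<longlonglongrightarrow> 0"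
proof -
  assume Q: "aas M Q"
  have eq: "measure_pmf.prob (M n) {x. \<not> Q n x} = 1 - measure_pmf.prob (M n) {x. Q n x}" for n
    using measure_pmf.prob_compl[of "{x. Q n x}" "M n"] by (simp add: Collect_neg_eq Compl_eq_Diff_UNIV)
  show ?thesis unfolding eq using tendsto_diff[OF tendsto_const[of 1] Q[unfolded aas_def]] by simp
qed

text \<open>The implication is asked for only on the support, where the edge set is known to lie
  between the two parts.\<close>

lemma aas_mono:
  assumes "aas M Q" "\<forall>\<^sub>F n in sequentially. \<forall>x\<in>set_pmf (M n). Q n x \<longrightarrow> R n x"
  shows "aas M R"
proof (rule aas_if_prob_le[OF _ aas_imp_prob[OF assms(1)]])
  show "\<forall>\<^sub>F n in sequentially. measure_pmf.prob (M n) {x. \<not> R n x} \<le> measure_pmf.prob (M n) {x. \<not> Q n x}"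
    using assms(2)
  proof eventually_elim
    case (elim n)
    have "measure_pmf.prob (M n) {x. \<not> R n x} = measure_pmf.prob (M n) ({x. \<not> R n x} \<inter> set_pmf (M n))"
      by (simp add: measure_Int_set_pmf)
    also have "\<dots> \<le> measure_pmf.prob (M n) {x. \<not> Q n x}"
      using elim by (intro measure_pmf.finite_measure_mono) auto
    finally show ?case .
  qed
qed

lemma aas_conj:
  assumes "aas M Q" "aas M R"
  shows "aas M (\<lambda>n x. Q n x \<and> R n x)"
proof (rule aas_if_prob_le)
  show "(\<lambda>n. measure_pmf.prob (M n) {x. \<not> Q n x} + measure_pmf.prob (M n) {x. \<not> R n x}) \<longlonglongrightarrow> 0"
    using tendsto_add[OF aas_imp_prob[OF assms(1)] aas_imp_prob[OF assms(2)]] by simp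
  have "measure_pmf.prob (M n) {x. \<not> (Q n x \<and> R n x)}
      \<le> measure_pmf.prob (M n) {x. \<not> Q n x} + measure_pmf.prob (M n) {x. \<not> R n x}" for n
  proof -
    have "{x. \<not> (Q n x \<and> R n x)} = {x. \<not> Q n x} \<union> {x. \<not> R n x}" by blast
    then show ?thesis by (simp add: measure_Un_le)
  qed
  then show "\<forall>\<^sub>F n in sequentially. measure_pmf.prob (M n) {x. \<not> (Q n x \<and> R n x)}
      \<le> measure_pmf.prob (M n) {x. \<not> Q n x} + measure_pmf.prob (M n) {x. \<not> R n x}" by simp
qed

section \<open>The lower bound\<close>

lemma alpha_equation:
  assumes "0 < c"
  shows "0 < alpha c" "2 * ln (alpha c) + c * alpha c = 2"
proof -
  have a: "0 < alpha c \<and> exp 2 / alpha c ^ 2 * exp (- (c * alpha c)) = 1"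
    unfolding alpha_def by (rule theI'[OF alpha_ex1[OF assms]])
  then show pos: "0 < alpha c" by simp
  have "alpha c ^ 2 = exp (2 * ln (alpha c))" using pos by (simp add: exp_double)
  then have "exp (2 - (2 * ln (alpha c) + c * alpha c)) = 1"
    using a by (simp add: exp_diff exp_minus exp_add field_simps)
  then show "2 * ln (alpha c) + c * alpha c = 2" by simp
qed

text \<open>Otherwise \<open>ln (alpha c) \<le> 0\<close> and \<open>c * alpha c < 1\<close>, and
  the logarithmic equation cannot reach 2. The bound makes \<open>k\<close> at least
  \<open>n / c\<close> in the estimate of empty rectangles and absorbs the rounding of
  \<open>k\<close>.\<close>

lemma alpha_ge:
  assumes "1 \<le> c"
  shows "1 / c \<le> alpha c"
proof (rule ccontr)
  assume "\<not> ?thesis"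
  then have lt: "alpha c < 1 / c" by simp
  have eq: "0 < alpha c" "2 * ln (alpha c) + c * alpha c = 2" using alpha_equation assms by auto
  have "alpha c \<le> 1" using lt assms by (smt (verit) divide_le_eq_1)
  then have "ln (alpha c) \<le> 0" using eq by simp
  moreover have "c * alpha c < 1" using lt assms by (simp add: field_simps)
  ultimately show False using eq by linarith
qed

lemma half_le_ln: "1 / 2 \<le> ln (c::real)" if "2 \<le> c"
proof -
  have "exp (1 / 2 :: real) \<le> 2"
  proof (rule power2_le_imp_le)
    show "(exp (1 / 2 :: real))\<^sup>2 \<le> 2\<^sup>2" using exp_le by (simp flip: exp_double)
  qed simp
  then have "exp (1 / 2) \<le> c" using that by linarith
  then show ?thesis using that by (subst ln_ge_iff) auto
qed

text \<open>At \<open>x = 4 * ln c / c\<close> the increasing function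
  \<open>2 * ln x + c * x\<close> equals \<open>2 * ln c + 4 * ln 2 + 2 * ln (ln c)\<close>. Since
  \<open>ln c \<ge> 1 / 2\<close>, this is at least
  \<open>2 * ln c + 2 * ln 2 \<ge> 2\<close>.\<close>

lemma alpha_le:
  assumes "2 \<le> c"
  shows "alpha c \<le> 4 * ln c / c"
proof (rule ccontr)
  assume "\<not> ?thesis"
  then have lt: "4 * ln c / c < alpha c" by simp
  have eq: "0 < alpha c" "2 * ln (alpha c) + c * alpha c = 2" using alpha_equation assms by auto
  have L: "1 / 2 \<le> ln c" "ln 2 \<le> ln c" "1 / 2 \<le> ln (2::real)" using half_le_ln assms by auto
  have pos: "0 < 4 * ln c / c" using L assms by simp
  have "ln (1 / 2) \<le> ln (ln c)" using L by (intro ln_mono) auto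
  moreover have "ln (4 * ln c / c) = 2 * ln 2 + ln (ln c) - ln c"
  proof -
    have "ln (4::real) = 2 * ln 2" using ln_realpow[of 2 2] by simp
    then show ?thesis using L assms by (simp add: ln_div ln_mult)
  qed
  moreover have "ln (4 * ln c / c) < ln (alpha c)" using lt pos by (subst ln_less_cancel_iff) (use eq in auto)
  moreover have "4 * ln c < c * alpha c" using lt assms by (simp add: field_simps)
  ultimately show False using eq L by (simp add: ln_div)
qed

text \<open>The constant \<open>e\<close> has to be sharp for empty rectangles, where its square
  becomes the \<open>exp 2\<close> in the equation for \<open>alpha\<close>. All other estimates can
  afford 3 instead.\<close>

lemma choose_le_power:
  assumes "1 \<le> k"
  shows "real (n choose k) \<le> (exp 1 * real n / real k) ^ k"
proof -
  have "real k ^ k / fact k \<le> exp (real k)"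
  proof -
    have "(\<Sum>i\<in>{k}. real k ^ i /\<^sub>R fact i) \<le> (\<Sum>i. real k ^ i /\<^sub>R fact i)"
      by (rule sum_le_suminf[OF summable_exp_generic]) auto
    then show ?thesis by (simp add: exp_def divide_inverse mult.commute)
  qed
  then have k: "real k ^ k \<le> exp 1 ^ k * fact k" by (simp add: field_simps exp_of_nat_mult[symmetric])
  have "real (n choose k) * fact k \<le> real n ^ k"
    using binomial_fact_pow[of n k] by (metis of_nat_fact of_nat_le_iff of_nat_mult of_nat_power)
  then have "real (n choose k) * fact k * real k ^ k \<le> real n ^ k * (exp 1 ^ k * fact k)"
    by (intro mult_mono k) auto
  then have "real (n choose k) * real k ^ k \<le> exp 1 ^ k * real n ^ k" by (simp add: mult_ac)
  then show ?thesis using assms by (simp add: power_mult_distrib power_divide field_simps)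
qed

lemma choose_le_power3:
  assumes "1 \<le> k"
  shows "real (n choose k) \<le> (3 * real n / real k) ^ k"
proof -
  have "(exp 1 * real n / real k) ^ k \<le> (3 * real n / real k) ^ k"
    using exp_le by (intro power_mono divide_right_mono mult_right_mono) auto
  then show ?thesis using choose_le_power[OF assms, of n] by linarith
qed

lemma admissible_eventually:
  assumes "admissible c"
  shows "\<forall>\<^sub>F n in sequentially. 2 \<le> c n \<and> c n \<le> (ln (real n))\<^sup>2 \<and> 2 \<le> ln (real n) \<and> 3 \<le> n
    \<and> c n / real n \<le> 1 / 2 \<and> 1 \<le> real n / (4 * c n ^ 4)"
proof -
  have "\<forall>\<^sub>F n in sequentially. 2 \<le> ln (real n)" by real_asymp
  moreover have "\<forall>\<^sub>F n in sequentially. (ln (real n))\<^sup>2 \<le> real n / 2" by real_asymp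
  moreover have "\<forall>\<^sub>F n in sequentially. 4 * ((ln (real n))\<^sup>2) ^ 4 \<le> real n" by real_asymp
  moreover have "\<forall>\<^sub>F n in sequentially. 3 \<le> n" by (rule eventually_ge_at_top)
  ultimately show ?thesis using assms[unfolded admissible_def]
  proof eventually_elim
    case (elim n)
    have "c n ^ 4 \<le> ((ln (real n))\<^sup>2) ^ 4" using elim by (intro power_mono) auto
    then have "4 * c n ^ 4 \<le> real n" using elim by linarith
    moreover have "0 < c n ^ 4" using elim by simp
    ultimately show ?case using elim by (simp add: field_simps)
  qed
qed

lemma ratio_tendsto_0:
  assumes "admissible c"
  shows "(\<lambda>n. c n / real n) \<longlonglongrightarrow> 0"
proof (rule tendsto_sandwich[where f = "\<lambda>_. 0"])
  show "(\<lambda>n. (ln (real n))\<^sup>2 / real n) \<longlonglongrightarrow> 0" by real_asymp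
  show "\<forall>\<^sub>F n in sequentially. c n / real n \<le> (ln (real n))\<^sup>2 / real n"
    using admissible_eventually[OF assms] by eventually_elim (auto intro: divide_right_mono)
  show "\<forall>\<^sub>F n in sequentially. 0 \<le> c n / real n"
    using admissible_eventually[OF assms] by eventually_elim auto
qed simp

text \<open>With \<open>x = k / n\<close> the expected number of empty rectangles is at most
  \<open>exp (k * (2 - (2 * ln x + C * x)))\<close>, and \<open>alpha C\<close> is the zero of the
  bracket. The slack \<open>1 + \<delta>\<close> lowers the bracket to \<open>- \<delta>\<close>
  through \<open>2 * ln (1 + \<delta>) \<ge> \<delta>\<close> alone, and
  \<open>k \<ge> n / C\<close> turns this into the stated exponent.\<close>

lemma hole_bound:
  assumes C: "2 \<le> C" "C \<le> real n" and \<delta>: "0 < \<delta>" "\<delta> \<le> 1 / 2" and k: "(1 + \<delta>) * alpha C * real n \<le> real k"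
  shows "real (n choose k) * real (n choose k) * (1 - C / real n) ^ (k * k) \<le> exp (- (\<delta> * (real n / C)))"
proof -
  have al: "0 < alpha C" "2 * ln (alpha C) + C * alpha C = 2" "1 / C \<le> alpha C"
    using alpha_equation alpha_ge C by auto
  have n: "0 < real n" using C by linarith
  define x where "x = real k / real n"
  have x: "(1 + \<delta>) * alpha C \<le> x" using k n by (simp add: x_def field_simps)
  then have x0: "0 < x" using al \<delta> by (smt (verit) mult_pos_pos)
  then have k0: "0 < k" by (cases "k = 0") (auto simp: x_def)
  have kx: "real k = x * real n" using n by (simp add: x_def)
  have ch: "real (n choose k) \<le> exp (real k * (1 - ln x))"
  proof -
    have "exp 1 * real n / real k = exp (1 - ln x)"
      using x0 n by (simp add: exp_diff kx field_simps)
    then have "(exp 1 * real n / real k) ^ k = exp (real k * (1 - ln x))"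
      by (simp add: exp_of_nat_mult)
    then show ?thesis using choose_le_power[of k n] k0 by simp
  qed
  have "1 - C / real n \<le> exp (- (C / real n))" using exp_ge_add_one_self[of "- (C / real n)"] by simp
  then have "(1 - C / real n) ^ (k * k) \<le> exp (- (C / real n)) ^ (k * k)"
    using C n by (intro power_mono) auto
  also have "\<dots> = exp (- (C * x * real k))"
    by (simp add: exp_of_nat_mult[symmetric] kx)
  finally have pw: "(1 - C / real n) ^ (k * k) \<le> exp (- (C * x * real k))" .
  have "real (n choose k) * real (n choose k) * (1 - C / real n) ^ (k * k)
      \<le> exp (real k * (1 - ln x)) * exp (real k * (1 - ln x)) * exp (- (C * x * real k))"
    using C n by (intro mult_mono ch pw) auto
  also have "\<dots> = exp (real k * (2 - (2 * ln x + C * x)))"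
    by (simp add: exp_add[symmetric] algebra_simps)
  also have "\<dots> \<le> exp (- (\<delta> * (real n / C)))"
  proof -
    have "ln ((1 + \<delta>) * alpha C) \<le> ln x" using x al \<delta> by (intro ln_mono) auto
    then have "ln (1 + \<delta>) + ln (alpha C) \<le> ln x" using al \<delta> by (simp add: ln_mult)
    moreover have "\<delta> / 2 \<le> ln (1 + \<delta>)"
    proof -
      have "\<delta> - \<delta>\<^sup>2 \<le> ln (1 + \<delta>)" using \<delta> by (intro ln_one_plus_pos_lower_bound) auto
      moreover have "\<delta> * \<delta> \<le> \<delta> * (1 / 2)" using \<delta> by (intro mult_left_mono) auto
      ultimately show ?thesis by (simp add: power2_eq_square)
    qed
    moreover have "alpha C \<le> x"
    proof -
      have "1 * alpha C \<le> (1 + \<delta>) * alpha C" using al \<delta> by (intro mult_right_mono) auto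
      then show ?thesis using x by linarith
    qed
    moreover from this have "C * alpha C \<le> C * x" using C by (intro mult_left_mono) auto
    ultimately have "2 - (2 * ln x + C * x) \<le> - \<delta>" using al by linarith
    then have "real k * (2 - (2 * ln x + C * x)) \<le> real k * (- \<delta>)" by (intro mult_left_mono) auto
    moreover have "\<delta> * (real n / C) \<le> \<delta> * real k"
    proof -
      have "1 / C * real n \<le> x * real n"
        using \<open>alpha C \<le> x\<close> al n by (intro mult_right_mono) auto
      then show ?thesis using \<delta> kx by (intro mult_left_mono) auto
    qed
    ultimately show ?thesis by (simp add: mult.commute)
  qed
  finally show ?thesis .
qed

text \<open>The error left when the area inequality is solved for the dimension:
  \<open>6 * c n * n\<close> bounds the number of edges, \<open>1 / ln n\<close> is the slack in the
  rectangle size, and the \<open>c n\<close> in the denominator absorbs the rounding of that size,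
  as \<open>1 \<le> alpha (c n) * c n\<close>.\<close>

definition dim_error :: "(nat \<Rightarrow> real) \<Rightarrow> nat \<Rightarrow> real" where
  "dim_error c n = 1 - (real n - 6 * c n - 1) / ((1 + 1 / ln (real n)) * real n + c n)"

lemma dim_error_tendsto_0:
  assumes "admissible c"
  shows "dim_error c \<longlonglongrightarrow> 0"
proof -
  have "(\<lambda>n. 1 / ln (real n)) \<longlonglongrightarrow> 0" "(\<lambda>n. 1 / real n) \<longlonglongrightarrow> 0" by real_asymp+
  then have "(\<lambda>n. 1 - (1 - 6 * (c n / real n) - 1 / real n) / (1 + 1 / ln (real n) + c n / real n))
      \<longlonglongrightarrow> 1 - (1 - 6 * 0 - 0) / (1 + 0 + 0)"
    using ratio_tendsto_0[OF assms] by (intro tendsto_intros) auto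
  moreover have "\<forall>\<^sub>F n in sequentially. dim_error c n
      = 1 - (1 - 6 * (c n / real n) - 1 / real n) / (1 + 1 / ln (real n) + c n / real n)"
    using admissible_eventually[OF assms]
  proof eventually_elim
    case (elim n)
    have "0 < real n" using elim by simp
    have "real n - 6 * c n - 1 = real n * (1 - 6 * (c n / real n) - 1 / real n)"
      "(1 + 1 / ln (real n)) * real n + c n = real n * (1 + 1 / ln (real n) + c n / real n)"
      using \<open>0 < real n\<close> by (simp_all add: field_simps)
    then show ?case using \<open>0 < real n\<close> by (simp add: dim_error_def)
  qed
  ultimately show ?thesis by (simp add: tendsto_cong)
qed

lemma aas_dim_ge:
  assumes "admissible c"
  shows "aas (\<lambda>n. random_bipartite n (c n / real n))
    (\<lambda>n E. (1 - dim_error c n) * (1 / (2 * alpha (c n))) \<le> real (bipartite_dim n E))"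
proof -
  \<comment> \<open>The slack \<open>1 / ln n\<close> tends to 0, yet its product with
    \<open>n / c n \<ge> n / (ln n)^2\<close> tends to infinity, so the bound on empty rectangles
    vanishes.\<close>
  define k where "k n = nat \<lceil>(1 + 1 / ln (real n)) * alpha (c n) * real n\<rceil>" for n
  \<comment> \<open>Six times the expected number of edges: the counting bound
    \<open>(3 * c n * n / m n)^(m n)\<close> is then at most \<open>(1 / 2)^(m n)\<close>.\<close>
  define m where "m n = nat \<lceil>6 * c n * real n\<rceil>" for n
  have "aas (\<lambda>n. random_bipartite n (c n / real n)) (\<lambda>n E. \<not> (\<exists>S T. S \<subseteq> left_part n \<and>
      T \<subseteq> right_part n \<and> card S = k n \<and> card T = k n \<and> S \<times> T \<inter> E = {}))"
  proof (rule aas_if_prob_le)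
    show "(\<lambda>n. exp (- (1 / ln (real n) * (real n / (ln (real n))\<^sup>2)))) \<longlonglongrightarrow> 0" by real_asymp
    show "\<forall>\<^sub>F n in sequentially. measure_pmf.prob (random_bipartite n (c n / real n))
        {E. \<not> \<not> (\<exists>S T. S \<subseteq> left_part n \<and> T \<subseteq> right_part n \<and> card S = k n \<and> card T = k n \<and> S \<times> T \<inter> E = {})}
        \<le> exp (- (1 / ln (real n) * (real n / (ln (real n))\<^sup>2)))"
      using admissible_eventually[OF assms]
    proof eventually_elim
      case (elim n)
      then have n: "0 < real n" and C: "2 \<le> c n" "c n \<le> real n" "c n \<le> (ln (real n))\<^sup>2" "2 \<le> ln (real n)"
        by (auto simp: field_simps)
      have p: "0 \<le> c n / real n" "c n / real n \<le> 1" using elim by auto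
      have "measure_pmf.prob (random_bipartite n (c n / real n))
        {E. \<not> \<not> (\<exists>S T. S \<subseteq> left_part n \<and> T \<subseteq> right_part n \<and> card S = k n \<and> card T = k n \<and> S \<times> T \<inter> E = {})}
        \<le> real (n choose k n) * real (n choose k n) * (1 - c n / real n) ^ (k n * k n)"
        unfolding not_not by (rule prob_hole[OF p])
      also have "\<dots> \<le> exp (- (1 / ln (real n) * (real n / c n)))"
      proof (rule hole_bound)
        show "(1 + 1 / ln (real n)) * alpha (c n) * real n \<le> real (k n)"
          unfolding k_def by (rule real_nat_ceiling_ge)
      qed (use C in \<open>auto simp: field_simps\<close>)
      also have "\<dots> \<le> exp (- (1 / ln (real n) * (real n / (ln (real n))\<^sup>2)))"
      proof -
        have "real n / (ln (real n))\<^sup>2 \<le> real n / c n" using C n by (intro divide_left_mono) auto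
        then have "1 / ln (real n) * (real n / (ln (real n))\<^sup>2) \<le> 1 / ln (real n) * (real n / c n)"
          using C by (intro mult_left_mono) auto
        then show ?thesis by simp
      qed
      finally show ?case .
    qed
  qed
  moreover have "aas (\<lambda>n. random_bipartite n (c n / real n))
      (\<lambda>n E. \<not> m n \<le> card (E \<inter> left_part n \<times> right_part n))"
  proof (rule aas_if_prob_le)
    show "(\<lambda>n. (1 / 2) ^ n :: real) \<longlonglongrightarrow> 0" by real_asymp
    show "\<forall>\<^sub>F n in sequentially. measure_pmf.prob (random_bipartite n (c n / real n))
        {E. \<not> \<not> m n \<le> card (E \<inter> left_part n \<times> right_part n)} \<le> (1 / 2) ^ n"
      using admissible_eventually[OF assms]
    proof eventually_elim
      case (elim n)
      then have n: "0 < real n" and C: "2 \<le> c n" by auto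
      have p: "0 \<le> c n / real n" "c n / real n \<le> 1" using elim by auto
      have m: "6 * c n * real n \<le> real (m n)" unfolding m_def by linarith
      have "6 * 2 * real n \<le> 6 * c n * real n" using C n by (intro mult_right_mono mult_left_mono) auto
      then have mn: "n \<le> m n" "0 < real (m n)" using m n by linarith+
      have "measure_pmf.prob (random_bipartite n (c n / real n))
          {E. \<not> \<not> m n \<le> card (E \<inter> left_part n \<times> right_part n)}
          \<le> real ((n * n) choose m n) * (c n / real n) ^ m n"
        unfolding not_not by (rule prob_edges[OF p])
      also have "\<dots> \<le> (3 * real (n * n) / real (m n)) ^ m n * (c n / real n) ^ m n"
        using mn p n by (intro mult_right_mono choose_le_power3) auto
      also have "\<dots> = (3 * c n * real n / real (m n)) ^ m n"
        using n by (simp add: mult_ac flip: power_mult_distrib)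
      also have "\<dots> \<le> (1 / 2) ^ m n"
        using m mn n C by (intro power_mono) (auto simp: field_simps)
      also have "\<dots> \<le> (1 / 2) ^ n" using mn by (intro power_decreasing) auto
      finally show ?case .
    qed
  qed
  ultimately have "aas (\<lambda>n. random_bipartite n (c n / real n)) (\<lambda>n E. \<not> (\<exists>S T. S \<subseteq> left_part n \<and>
      T \<subseteq> right_part n \<and> card S = k n \<and> card T = k n \<and> S \<times> T \<inter> E = {}) \<and>
      \<not> m n \<le> card (E \<inter> left_part n \<times> right_part n))"
    by (rule aas_conj)
  then show ?thesis
  proof (rule aas_mono)
    show "\<forall>\<^sub>F n in sequentially. \<forall>E\<in>set_pmf (random_bipartite n (c n / real n)).
      \<not> (\<exists>S T. S \<subseteq> left_part n \<and> T \<subseteq> right_part n \<and> card S = k n \<and> card T = k n \<and> S \<times> T \<inter> E = {}) \<and>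
      \<not> m n \<le> card (E \<inter> left_part n \<times> right_part n) \<longrightarrow>
      (1 - dim_error c n) * (1 / (2 * alpha (c n))) \<le> real (bipartite_dim n E)"
      using admissible_eventually[OF assms]
    proof (eventually_elim, intro ballI impI, elim conjE)
      fix n E
      assume n: "2 \<le> c n" "2 \<le> ln (real n)" "3 \<le> n"
        and E: "E \<in> set_pmf (random_bipartite n (c n / real n))"
        and hole: "\<not> (\<exists>S T. S \<subseteq> left_part n \<and> T \<subseteq> right_part n \<and> card S = k n \<and> card T = k n \<and> S \<times> T \<inter> E = {})"
        and edges: "\<not> m n \<le> card (E \<inter> left_part n \<times> right_part n)"
      have sub: "E \<subseteq> left_part n \<times> right_part n" by (rule random_bipartite_subset[OF E])
      define d where "d = real (bipartite_dim n E)"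
      define w where "w = (1 + 1 / ln (real n)) * real n + c n"
      have al: "0 < alpha (c n)" "1 / c n \<le> alpha (c n)" using alpha_equation(1) alpha_ge n by auto
      have "n * n \<le> card E + bipartite_dim n E * (2 * k n * n)"
        by (rule area_le_dim[OF sub]) (use hole in blast)
      then have "real (n * n) \<le> real (card E + bipartite_dim n E * (2 * k n * n))"
        by (rule of_nat_mono)
      then have area: "real n * real n \<le> real (card E) + d * (2 * real (k n) * real n)"
        by (simp add: d_def)
      have "E \<inter> left_part n \<times> right_part n = E" using sub by blast
      then have "real (card E) \<le> 6 * c n * real n"
        using edges unfolding m_def by (simp add: not_le)
      then have "real n * (real n - 6 * c n) \<le> real n * (d * (2 * real (k n)))"
        using area by (simp add: algebra_simps)
      then have "real n - 6 * c n \<le> d * (2 * real (k n))" using n by simp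
      also have "\<dots> \<le> d * (2 * (alpha (c n) * w))"
      proof -
        have pos: "0 \<le> (1 + 1 / ln (real n)) * alpha (c n) * real n" using n al by (intro mult_nonneg_nonneg) auto
        have "1 \<le> alpha (c n) * c n" using al n by (simp add: field_simps)
        then have "real (k n) \<le> alpha (c n) * w"
          using pos unfolding k_def w_def by (simp add: algebra_simps) linarith
        then show ?thesis by (intro mult_left_mono) (auto simp: d_def)
      qed
      finally have "real n - 6 * c n - 1 \<le> d * (2 * alpha (c n)) * w" by (simp add: mult_ac)
      moreover have "0 < w" unfolding w_def using n by (intro add_pos_pos mult_pos_pos) (auto intro: add_pos_pos)
      ultimately have "1 - dim_error c n \<le> d * (2 * alpha (c n))"
        unfolding dim_error_def w_def[symmetric] by (simp add: field_simps)
      then show "(1 - dim_error c n) * (1 / (2 * alpha (c n))) \<le> real (bipartite_dim n E)"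
        using al by (simp add: d_def[symmetric] field_simps)
    qed
  qed
qed

lemma aas_dim_ge_log:
  assumes "admissible c"
  shows "aas (\<lambda>n. random_bipartite n (c n / real n))
    (\<lambda>n E. 1 / 16 * c n / ln (c n) \<le> real (bipartite_dim n E))"
proof (rule aas_mono[OF aas_dim_ge[OF assms]])
  have "\<forall>\<^sub>F n in sequentially. dim_error c n < 1 / 2"
    using dim_error_tendsto_0[OF assms] by (rule order_tendstoD) simp
  then show "\<forall>\<^sub>F n in sequentially. \<forall>E\<in>set_pmf (random_bipartite n (c n / real n)).
      (1 - dim_error c n) * (1 / (2 * alpha (c n))) \<le> real (bipartite_dim n E) \<longrightarrow>
      1 / 16 * c n / ln (c n) \<le> real (bipartite_dim n E)"
    using admissible_eventually[OF assms]
  proof eventually_elim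
    case (elim n)
    then have al: "0 < alpha (c n)" "alpha (c n) \<le> 4 * ln (c n) / c n" and L: "1 / 2 \<le> ln (c n)"
      using alpha_equation(1) alpha_le half_le_ln by auto
    \<comment> \<open>The constant is \<open>1/2 * 1/2 * 1/4\<close>: the error is below one half,
      the second factor is the one in \<open>1 / (2 * alpha (c n))\<close>, and the last comes from
      \<open>alpha (c n) \<le> 4 * ln (c n) / c n\<close>.\<close>
    have "1 / 16 * c n / ln (c n) = 1 / 2 * (1 / (2 * (4 * ln (c n) / c n)))" using elim by simp
    also have "\<dots> \<le> (1 - dim_error c n) * (1 / (2 * alpha (c n)))"
      using elim al L by (intro mult_mono divide_left_mono) auto
    finally show ?case by auto
  qed
qed

section \<open>The upper bound\<close>

text \<open>For \<open>(j, m)\<close> the values \<open>(2, 2)\<close> and \<open>(3, 1)\<close> are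
  used: excluding the first bounds conflict graphs, excluding the second yields 2-degeneracy. In
  both, \<open>s + m * s\<close> vertices carry \<open>j * m * s\<close> edges, \<open>s\<close>
  more than vertices, so the first moment decays like \<open>(s / n)^s\<close> up to constants and
  powers of \<open>C\<close> in the base.\<close>

definition crowded :: "('a \<times> 'b) set \<Rightarrow> 'a set \<Rightarrow> 'b set \<Rightarrow> nat \<Rightarrow> nat \<Rightarrow> nat \<Rightarrow> bool" where
  "crowded E A B j m s0 \<longleftrightarrow> (\<exists>S\<subseteq>B. S \<noteq> {} \<and> card S \<le> s0 \<and>
     m * card S \<le> card {a\<in>A. j \<le> card {b\<in>S. (a, b) \<in> E}})"

lemma crowded_term_2:
  assumes "1 \<le> s" "0 \<le> p"
  shows "real (n choose s) * real (n choose (2 * s)) * (real (s choose 2) * p ^ 2) ^ (2 * s)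
    \<le> (2 * (p * real n) ^ 4 * (real s / real n)) ^ s"
proof (cases "n = 0")
  case True
  then show ?thesis using assms(1) by (cases s) auto
next
  case False
  have c2: "real (s choose 2) \<le> real s ^ 2 / 2"
    using binomial_fact_pow[of s 2]
    by (metis fact_2 le_divide_eq_numeral1(1) of_nat_le_iff of_nat_mult of_nat_numeral of_nat_power)
  have "real (n choose s) * real (n choose (2 * s)) * (real (s choose 2) * p ^ 2) ^ (2 * s)
      \<le> (3 * real n / real s) ^ s * (3 * real n / real (2 * s)) ^ (2 * s) * (real s ^ 2 / 2 * p ^ 2) ^ (2 * s)"
    using assms by (intro mult_mono choose_le_power3 power_mono c2 mult_right_mono) auto
  also have "\<dots> = ((3 * real n / real s) * (3 * real n / real (2 * s)) ^ 2 * (real s ^ 2 / 2 * p ^ 2) ^ 2) ^ s"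
    by (simp only: power_mult power_mult_distrib)
  also have "(3 * real n / real s) * (3 * real n / real (2 * s)) ^ 2 * (real s ^ 2 / 2 * p ^ 2) ^ 2
      = 27 / 16 * (p * real n) ^ 4 * (real s / real n)"
    using assms False by (simp add: field_simps power2_eq_square power4_eq_xxxx)
  also have "(27 / 16 * (p * real n) ^ 4 * (real s / real n)) ^ s
      \<le> (2 * (p * real n) ^ 4 * (real s / real n)) ^ s"
    by (intro power_mono mult_right_mono) auto
  finally show ?thesis .
qed

lemma crowded_term_3:
  assumes "1 \<le> s" "0 \<le> p" "1 \<le> p * real n"
  shows "real (n choose s) * real (n choose (1 * s)) * (real (s choose 3) * p ^ 3) ^ (1 * s)
    \<le> (2 * (p * real n) ^ 4 * (real s / real n)) ^ s"
proof -
  have n: "0 < real n" using assms(3) by (cases "n = 0") auto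
  have c3: "real (s choose 3) \<le> real s ^ 3 / 6"
  proof -
    have "real ((s choose 3) * fact 3) \<le> real (s ^ 3)" using binomial_fact_pow[of s 3] by (rule of_nat_mono)
    then show ?thesis by (simp add: fact_numeral)
  qed
  have "real (n choose s) * real (n choose (1 * s)) * (real (s choose 3) * p ^ 3) ^ (1 * s)
      \<le> (3 * real n / real s) ^ s * (3 * real n / real s) ^ s * (real s ^ 3 / 6 * p ^ 3) ^ s"
    unfolding mult_1 using assms by (intro mult_mono choose_le_power3 power_mono c3 mult_right_mono) auto
  also have "\<dots> = ((3 * real n / real s) * (3 * real n / real s) * (real s ^ 3 / 6 * p ^ 3)) ^ s"
    by (simp only: power_mult_distrib)
  also have "(3 * real n / real s) * (3 * real n / real s) * (real s ^ 3 / 6 * p ^ 3)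
      = 3 / 2 * (p * real n) ^ 3 * (real s / real n)"
    using assms n by (simp add: field_simps power3_eq_cube)
  \<comment> \<open>Since \<open>p * n \<ge> 1\<close>, the third power may be raised to the fourth;
    both kinds of crowding then share one bound.\<close>
  also have "(3 / 2 * (p * real n) ^ 3 * (real s / real n)) ^ s
      \<le> (2 * (p * real n) ^ 4 * (real s / real n)) ^ s"
    using assms by (intro power_mono mult_right_mono mult_mono power_increasing) auto
  finally show ?thesis .
qed

lemma sum_halves: "(\<Sum>s=1..m. real s * (1 / 2) ^ s) = 2 - (real m + 2) / 2 ^ m"
proof (induction m)
  case (Suc m)
  have "(1 / 2 :: real) ^ Suc m = 1 / (2 * 2 ^ m)" by (simp add: power_divide)
  then show ?case using Suc by (simp add: add_divide_distrib)
qed simp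

text \<open>Every base is at most \<open>1 / 2\<close>. Keeping one factor \<open>z * s\<close> and
  replacing the others by \<open>1 / 2\<close> makes the sum proportional to \<open>z\<close>, with
  \<open>s / 2^s\<close> summing to less than 2.\<close>

lemma sum_powers_le:
  assumes "0 \<le> z" "z * real m \<le> 1 / 2"
  shows "(\<Sum>s=1..m. (z * real s) ^ s) \<le> 4 * z"
proof -
  have "(z * real s) ^ s \<le> 2 * z * (real s * (1 / 2) ^ s)" if sm: "s \<in> {1..m}" for s
  proof -
    obtain i where s: "s = Suc i" using sm by (cases s) auto
    have "z * real s \<le> z * real m" using sm assms by (intro mult_left_mono) auto
    then have "(z * real s) ^ i \<le> (1 / 2) ^ i" using assms by (intro power_mono) auto
    then have "(z * real s) * (z * real s) ^ i \<le> (z * real s) * (1 / 2) ^ i"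
      using assms by (intro mult_left_mono) auto
    then show ?thesis by (simp add: s)
  qed
  then have "(\<Sum>s=1..m. (z * real s) ^ s) \<le> (\<Sum>s=1..m. 2 * z * (real s * (1 / 2) ^ s))"
    by (rule sum_mono)
  also have "\<dots> = 2 * z * (\<Sum>s=1..m. real s * (1 / 2) ^ s)" by (simp add: sum_distrib_left)
  also have "\<dots> \<le> 2 * z * 2"
    unfolding sum_halves using assms by (intro mult_left_mono) auto
  finally show ?thesis by simp
qed

text \<open>Up to this size the base \<open>2 * C^4 * s / n\<close> of the first-moment terms is at
  most \<open>1 / 2\<close>.\<close>

definition crowd_size :: "real \<Rightarrow> nat \<Rightarrow> nat" where
  "crowd_size C n = nat \<lfloor>real n / (4 * C ^ 4)\<rfloor>"

lemma prob_crowded_le: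
  fixes e :: "'a \<Rightarrow> 'b \<Rightarrow> nat \<times> nat"
  assumes C: "2 \<le> C" "C / real n \<le> 1" "0 < n"
    and A: "finite A" "card A = n" and B: "finite B" "card B = n"
    and inj: "inj_on (\<lambda>(a, b). e a b) (A \<times> B)"
    and ran: "\<And>a b. a \<in> A \<Longrightarrow> b \<in> B \<Longrightarrow> e a b \<in> left_part n \<times> right_part n"
    and jm: "j = 2 \<and> m = 2 \<or> j = 3 \<and> m = 1"
  shows "measure_pmf.prob (random_bipartite n (C / real n))
      {E. crowded {(a, b). e a b \<in> E} A B j m (crowd_size C n)} \<le> 8 * C ^ 4 / real n"
proof -
  define p where "p = C / real n"
  have p: "0 \<le> p" "p \<le> 1" "p * real n = C" using C by (auto simp: p_def)
  define Y where "Y s = {E. \<exists>S\<subseteq>B. card S = s \<and> m * s \<le> card {a\<in>A. j \<le> card {b\<in>S. e a b \<in> E}}}" for s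
  define z where "z = 2 * C ^ 4 / real n"
  have size: "real (crowd_size C n) \<le> real n / (4 * C ^ 4)"
    unfolding crowd_size_def using C by (intro of_nat_floor) auto
  have small: "measure_pmf.prob (random_bipartite n p) (Y s) \<le> (z * real s) ^ s" if "1 \<le> s" for s
  proof -
    have "measure_pmf.prob (random_bipartite n p) (Y s)
        \<le> real (n choose s) * real (n choose (m * s)) * (real (s choose j) * p ^ j) ^ (m * s)"
      unfolding Y_def by (rule prob_crowded[OF p(1,2) A B inj ran])
    also have "\<dots> \<le> (2 * (p * real n) ^ 4 * (real s / real n)) ^ s"
      using jm crowded_term_2[OF that p(1)] crowded_term_3[OF that p(1)] p C by auto
    finally show ?thesis by (simp add: p(3) z_def)
  qed
  have "{E. crowded {(a, b). e a b \<in> E} A B j m (crowd_size C n)} \<subseteq> (\<Union>s\<in>{1..crowd_size C n}. Y s)"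
  proof
    fix E assume "E \<in> {E. crowded {(a, b). e a b \<in> E} A B j m (crowd_size C n)}"
    then obtain S where S: "S \<subseteq> B" "S \<noteq> {}" "card S \<le> crowd_size C n"
      "m * card S \<le> card {a\<in>A. j \<le> card {b\<in>S. e a b \<in> E}}" by (auto simp: crowded_def)
    have "finite S" using S(1) B(1) finite_subset by blast
    then have "card S \<in> {1..crowd_size C n}" using S by (simp add: Suc_le_eq card_gt_0_iff)
    moreover have "E \<in> Y (card S)" using S unfolding Y_def by blast
    ultimately show "E \<in> (\<Union>s\<in>{1..crowd_size C n}. Y s)" by blast
  qed
  then have "measure_pmf.prob (random_bipartite n p) {E. crowded {(a, b). e a b \<in> E} A B j m (crowd_size C n)}
      \<le> measure_pmf.prob (random_bipartite n p) (\<Union>s\<in>{1..crowd_size C n}. Y s)"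
    by (intro measure_pmf.finite_measure_mono) auto
  also have "\<dots> \<le> (\<Sum>s\<in>{1..crowd_size C n}. measure_pmf.prob (random_bipartite n p) (Y s))"
    by (intro measure_pmf.finite_measure_subadditive_finite) auto
  also have "\<dots> \<le> (\<Sum>s=1..crowd_size C n. (z * real s) ^ s)" using small by (intro sum_mono) auto
  also have "\<dots> \<le> 4 * z"
  proof (rule sum_powers_le)
    have "z * real (crowd_size C n) \<le> z * (real n / (4 * C ^ 4))"
      using size C by (intro mult_left_mono) (auto simp: z_def)
    also have "\<dots> = 1 / 2" using C by (simp add: z_def)
    finally show "z * real (crowd_size C n) \<le> 1 / 2" .
  qed (use C in \<open>auto simp: z_def\<close>)
  finally show ?thesis by (simp add: p_def z_def)
qed

lemma polylog_tendsto_0: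
  assumes "admissible c"
  shows "(\<lambda>n. 8 * c n ^ 4 / real n) \<longlonglongrightarrow> 0"
proof (rule tendsto_sandwich[where f = "\<lambda>_. 0"])
  show "(\<lambda>n. 8 * ((ln (real n))\<^sup>2) ^ 4 / real n) \<longlonglongrightarrow> 0" by real_asymp
  show "\<forall>\<^sub>F n in sequentially. 8 * c n ^ 4 / real n \<le> 8 * ((ln (real n))\<^sup>2) ^ 4 / real n"
    using admissible_eventually[OF assms]
  proof eventually_elim
    case (elim n)
    then have "c n ^ 4 \<le> ((ln (real n))\<^sup>2) ^ 4" by (intro power_mono) auto
    then show ?case by (intro divide_right_mono mult_left_mono) auto
  qed
  show "\<forall>\<^sub>F n in sequentially. 0 \<le> 8 * c n ^ 4 / real n"
    using admissible_eventually[OF assms] by eventually_elim auto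
qed simp

lemma aas_not_crowded:
  assumes c: "admissible c" and jm: "j = 2 \<and> m = 2 \<or> j = 3 \<and> m = 1"
  shows "aas (\<lambda>n. random_bipartite n (c n / real n))
      (\<lambda>n E. \<not> crowded E (left_part n) (right_part n) j m (crowd_size (c n) n))"
    and "aas (\<lambda>n. random_bipartite n (c n / real n))
      (\<lambda>n E. \<not> crowded (E\<inverse>) (right_part n) (left_part n) j m (crowd_size (c n) n))"
proof -
  show "aas (\<lambda>n. random_bipartite n (c n / real n))
      (\<lambda>n E. \<not> crowded E (left_part n) (right_part n) j m (crowd_size (c n) n))"
  proof (rule aas_if_prob_le[OF _ polylog_tendsto_0[OF c]])
    show "\<forall>\<^sub>F n in sequentially. measure_pmf.prob (random_bipartite n (c n / real n))
        {E. \<not> \<not> crowded E (left_part n) (right_part n) j m (crowd_size (c n) n)} \<le> 8 * c n ^ 4 / real n"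
      using admissible_eventually[OF c]
    proof eventually_elim
      case (elim n)
      have "{(a, b). Pair a b \<in> E} = E" for E :: "(nat \<times> nat) set" by auto
      then show ?case
        using prob_crowded_le[of "c n" n "left_part n" "right_part n" Pair j m] elim jm
        by (auto simp: inj_on_def)
    qed
  qed
  show "aas (\<lambda>n. random_bipartite n (c n / real n))
      (\<lambda>n E. \<not> crowded (E\<inverse>) (right_part n) (left_part n) j m (crowd_size (c n) n))"
  proof (rule aas_if_prob_le[OF _ polylog_tendsto_0[OF c]])
    show "\<forall>\<^sub>F n in sequentially. measure_pmf.prob (random_bipartite n (c n / real n))
        {E. \<not> \<not> crowded (E\<inverse>) (right_part n) (left_part n) j m (crowd_size (c n) n)} \<le> 8 * c n ^ 4 / real n"
      using admissible_eventually[OF c]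
    proof eventually_elim
      case (elim n)
      have "{(b, a). (\<lambda>b a. (a, b)) b a \<in> E} = E\<inverse>" for E :: "(nat \<times> nat) set" by auto
      then show ?case
        using prob_crowded_le[of "c n" n "right_part n" "left_part n" "\<lambda>b a. (a, b)" j m] elim jm
        by (auto simp: inj_on_def)
    qed
  qed
qed

section \<open>Blocks and exceptional vertices\<close>

definition block_size :: "real \<Rightarrow> nat \<Rightarrow> nat" where
  "block_size C n = nat \<lceil>real n * ln C / C\<rceil>"
text \<open>The \<open>+ 1\<close> is for the remainder block, which is empty if the division is
  exact.\<close>

definition blocks :: "real \<Rightarrow> nat \<Rightarrow> nat" where
  "blocks C n = n div block_size C n + 1"
definition block :: "real \<Rightarrow> nat \<Rightarrow> nat \<Rightarrow> nat set" where
  "block C n i = {b\<in>right_part n. (b - (n + 1)) div block_size C n = i}"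
text \<open>The expected degree into a block is at most \<open>2 * ln C\<close>. The factor 48 makes
  the base \<open>3 * 2 / 48 = 1 / 8\<close> of the tail bound smaller than \<open>1 / e\<close>,
  and the tail \<open>C^(-48)\<close> beats both the at most \<open>4 * C\<close> blocks and the
  factor \<open>12 * C^4\<close> from choosing the exceptional set.\<close>

definition degree_bound :: "real \<Rightarrow> nat" where
  "degree_bound C = nat \<lceil>48 * ln C\<rceil>"

lemma block_size_pos: "0 < block_size C n" if "2 \<le> C" "0 < n"
proof -
  have "0 < real n * ln C / C" using that by simp
  then show ?thesis unfolding block_size_def by simp
qed

lemma blocks_le: "real (blocks C n) \<le> 2 * C / ln C" if "2 \<le> C" "0 < n"
proof -
  have pos: "0 < real n * ln C / C" using that by simp
  have y: "real n * ln C / C \<le> real (block_size C n)" unfolding block_size_def by (rule real_nat_ceiling_ge)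
  have "real (n div block_size C n) \<le> real n / real (block_size C n)" by (rule of_nat_div_le_of_nat)
  also have "\<dots> \<le> real n / (real n * ln C / C)"
  proof (rule divide_left_mono[OF y])
    have "0 < real (block_size C n)" using y pos by linarith
    then show "0 < real (block_size C n) * (real n * ln C / C)" using pos by (rule mult_pos_pos)
  qed simp
  also have "\<dots> = C / ln C" using that by simp
  finally have "real (n div block_size C n) \<le> C / ln C" .
  moreover have "1 \<le> C / ln C"
    using that ln_le_minus_one[of C] by (simp add: field_simps)
  ultimately show ?thesis by (simp add: blocks_def)
qed

lemma UN_block: "right_part n = (\<Union>i<blocks C n. block C n i)"
proof -
  have "(b - (n + 1)) div block_size C n < blocks C n" if "b \<in> right_part n" for b
    unfolding blocks_def using that by (auto simp: less_Suc_eq_le intro!: div_le_mono)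
  then show ?thesis by (auto simp: block_def)
qed

lemma card_block_le: "card (block C n i) \<le> block_size C n" if "0 < block_size C n"
proof -
  have "block C n i \<subseteq> {n + 1 + i * block_size C n..<n + 1 + i * block_size C n + block_size C n}"
  proof
    fix b assume b: "b \<in> block C n i"
    define d where "d = b - (n + 1)"
    have "b = n + 1 + d" "d div block_size C n = i" using b by (auto simp: block_def d_def)
    moreover have "d = d div block_size C n * block_size C n + d mod block_size C n"
      by (rule div_mult_mod_eq[symmetric])
    moreover have "d mod block_size C n < block_size C n" using that by simp
    ultimately show "b \<in> {n + 1 + i * block_size C n..<n + 1 + i * block_size C n + block_size C n}"
      by (metis add.assoc add_less_cancel_left atLeastLessThan_iff le_add1)
  qed
  from card_mono[OF _ this] show ?thesis by simp
qed

lemma aas_exceptional: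
  assumes c: "admissible c"
  shows "aas (\<lambda>n. random_bipartite n (c n / real n))
    (\<lambda>n E. card {a\<in>left_part n. \<exists>i<blocks (c n) n. degree_bound (c n) < card {b\<in>block (c n) n i. (a, b) \<in> E}}
      \<le> crowd_size (c n) n)"
proof (rule aas_if_prob_le)
  show "(\<lambda>n. (1 / 2) powr (real n / (4 * ((ln (real n))\<^sup>2) ^ 4))) \<longlonglongrightarrow> 0" by real_asymp
  show "\<forall>\<^sub>F n in sequentially. measure_pmf.prob (random_bipartite n (c n / real n))
      {E. \<not> card {a\<in>left_part n. \<exists>i<blocks (c n) n. degree_bound (c n) < card {b\<in>block (c n) n i. (a, b) \<in> E}}
        \<le> crowd_size (c n) n}
    \<le> (1 / 2) powr (real n / (4 * ((ln (real n))\<^sup>2) ^ 4))"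
    using admissible_eventually[OF c]
  proof eventually_elim
    case (elim n)
    define C where "C = c n"
    define p where "p = C / real n"
    \<comment> \<open>One more than the allowed size, so that \<open>s\<close> exceptional vertices
      are exactly the failure; the increment also undoes the floor, giving
      \<open>s \<ge> n / (4 * C^4)\<close>.\<close>
    define s where "s = crowd_size C n + 1"
    define r where "r = degree_bound C"
    define y where "y = block_size C n"
    define q where "q = blocks C n"
    have C: "2 \<le> C" "C / real n \<le> 1 / 2" "C \<le> (ln (real n))\<^sup>2" "2 \<le> ln (real n)" and n: "0 < n"
      using elim by (auto simp: C_def)
    have L: "1 / 2 \<le> ln C" using half_le_ln C by simp
    have p: "0 \<le> p" "p \<le> 1" unfolding p_def using C by (simp, linarith)
    have y0: "0 < y" unfolding y_def by (rule block_size_pos[OF C(1) n])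
    have s: "real n / (4 * C ^ 4) \<le> real s"
      unfolding s_def crowd_size_def by linarith
    have s0: "0 < real s" by (simp add: s_def)
    have r: "48 * ln C \<le> real (r + 1)" unfolding r_def degree_bound_def by linarith
    have q: "real q \<le> 4 * C"
    proof -
      have "2 * C / ln C \<le> 2 * C / (1 / 2)" using C L by (intro divide_left_mono) auto
      then show ?thesis using blocks_le[OF C(1) n] by (simp add: q_def)
    qed
    have "0 \<le> real n * ln C / C" using C L by simp
    then have "real y \<le> real n * ln C / C + 1" unfolding y_def block_size_def by linarith
    then have "real y * p \<le> (real n * ln C / C + 1) * p" using p by (intro mult_right_mono) auto
    also have "\<dots> = ln C + C / real n" using C n by (simp add: p_def field_simps)
    \<comment> \<open>The rounding of the block size contributes
      \<open>C / n \<le> 1 / 2 \<le> ln C\<close>.\<close>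
    also have "\<dots> \<le> 2 * ln C" using C L by linarith
    finally have yp: "real y * p \<le> 2 * ln C" .
    have "measure_pmf.prob (random_bipartite n p)
        {E. s \<le> card {a\<in>left_part n. \<exists>i<q. r < card {b\<in>block C n i. (a, b) \<in> E}}}
      \<le> real (n choose s) * (real q * real (y choose (r + 1)) * p ^ (r + 1)) ^ s"
      by (rule prob_exceptional[OF p]) (use card_block_le y0 in \<open>auto simp: block_def y_def\<close>)
    also have "\<dots> \<le> (3 * real n / real s) ^ s * (real q * (3 * real y / real (r + 1)) ^ (r + 1) * p ^ (r + 1)) ^ s"
      using p by (intro mult_mono power_mono mult_right_mono mult_left_mono choose_le_power3) (auto simp: s_def)
    also have "\<dots> = ((3 * real n / real s) * real q * (3 * (real y * p) / real (r + 1)) ^ (r + 1)) ^ s"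
      by (simp add: power_mult_distrib[symmetric] mult_ac)
    also have "\<dots> \<le> (1 / 2) ^ s"
    proof (rule power_mono)
      have "3 * (real y * p) / real (r + 1) \<le> 1 / 8" using yp r by (simp add: field_simps)
      also have "\<dots> \<le> exp (- 1)" using exp_le by (simp add: exp_minus field_simps)
      finally have "(3 * (real y * p) / real (r + 1)) ^ (r + 1) \<le> exp (- 1) ^ (r + 1)"
        using p by (intro power_mono) auto
      also have "\<dots> = exp (- real (r + 1))" by (subst exp_of_nat_mult[symmetric]) simp
      also have "\<dots> \<le> exp (- (48 * ln C))" using r by simp
      also have "\<dots> = 1 / C ^ 48"
      proof -
        have "exp (48 * ln C) = C ^ 48" using exp_of_nat_mult[of 48 "ln C"] C by simp
        then show ?thesis by (simp add: exp_minus divide_inverse)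
      qed
      finally have e: "(3 * (real y * p) / real (r + 1)) ^ (r + 1) \<le> 1 / C ^ 48" .
      have "3 * real n / real s \<le> 12 * C ^ 4"
        using s s0 C by (simp add: field_simps)
      then have "(3 * real n / real s) * real q * (3 * (real y * p) / real (r + 1)) ^ (r + 1)
          \<le> (12 * C ^ 4) * (4 * C) * (1 / C ^ 48)"
        using C p by (intro mult_mono e q) auto
      also have "\<dots> = 48 / C ^ 43"
      proof -
        have "C ^ 48 = C ^ 4 * C * C ^ 43" by (simp flip: power_Suc2 power_add)
        then show ?thesis using C by simp
      qed
      also have "\<dots> \<le> 48 / 2 ^ 43" using C by (intro divide_left_mono power_mono) auto
      also have "\<dots> \<le> 1 / 2" by simp
      finally show "(3 * real n / real s) * real q * (3 * (real y * p) / real (r + 1)) ^ (r + 1) \<le> 1 / 2" .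
    qed (use p in auto)
    also have "\<dots> = (1 / 2) powr real s" by (simp add: powr_realpow)
    also have "\<dots> \<le> (1 / 2) powr (real n / (4 * ((ln (real n))\<^sup>2) ^ 4))"
    proof (rule powr_mono')
      have "real n / (4 * ((ln (real n))\<^sup>2) ^ 4) \<le> real n / (4 * C ^ 4)"
        using C by (intro divide_left_mono mult_left_mono power_mono) auto
      then show "real n / (4 * ((ln (real n))\<^sup>2) ^ 4) \<le> real s" using s by linarith
    qed auto
    finally show ?case by (simp add: s_def p_def q_def r_def C_def Suc_le_eq not_le)
  qed
qed

text \<open>The number of orders used for one block is linear in \<open>(ln C) ^ 3\<close>, and there are about
  \<open>C / ln C\<close> blocks.\<close>

lemma dim_le_if_sparse:
  fixes C :: real
  assumes C: "2 \<le> C" "1 \<le> real n / (4 * C ^ 4)" and E: "E \<subseteq> left_part n \<times> right_part n"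
    and left: "\<not> crowded E (left_part n) (right_part n) 2 2 (crowd_size C n)"
      "\<not> crowded E (left_part n) (right_part n) 3 1 (crowd_size C n)"
    and right: "\<not> crowded (E\<inverse>) (right_part n) (left_part n) 2 2 (crowd_size C n)"
      "\<not> crowded (E\<inverse>) (right_part n) (left_part n) 3 1 (crowd_size C n)"
    and exceptional: "card {a\<in>left_part n. \<exists>i<blocks C n. degree_bound C < card {b\<in>block C n i. (a, b) \<in> E}}
      \<le> crowd_size C n"
  shows "real (bipartite_dim n E) \<le> 700000 * C * (ln C)\<^sup>2"
proof -
  define s0 where "s0 = crowd_size C n"
  define r where "r = degree_bound C"
  define q where "q = blocks C n"
  \<comment> \<open>\<open>M\<close> has to satisfy \<open>n \<le> M * s0\<close>. The floor of a
    number that is at least 1 loses at most a factor 2, so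
    \<open>s0 \<ge> n / (8 * C^4)\<close>.\<close>
  define M where "M = nat \<lceil>8 * C ^ 4\<rceil>"
  define t where "t = nat \<lceil>3 * real (r + 1) ^ 2 * ln (real (M * r\<^sup>2 + 2))\<rceil> + 1"
  define L where "L = ln C"
  have n: "0 < n" using C by (cases "n = 0") auto
  have L: "1 / 2 \<le> L" "L \<le> C" using half_le_ln[OF C(1)] ln_le_minus_one[of C] C by (auto simp: L_def)
  have C1: "1 \<le> C ^ 4" using C by simp
  have M: "8 * C ^ 4 \<le> real M" "real M \<le> 9 * C ^ 4" unfolding M_def using C1 by linarith+
  have s0: "real n / (8 * C ^ 4) \<le> real s0"
  proof -
    define z where "z = real n / (4 * C ^ 4)"
    have "1 \<le> \<lfloor>z\<rfloor>" using C(2) by (simp add: z_def)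
    then have "real s0 = of_int \<lfloor>z\<rfloor>" "1 \<le> real_of_int \<lfloor>z\<rfloor>" by (simp_all add: s0_def crowd_size_def z_def)
    then have "real n / (4 * C ^ 4) / 2 \<le> real s0" unfolding z_def[symmetric] by linarith
    then show ?thesis by simp
  qed
  have "real n = 8 * C ^ 4 * (real n / (8 * C ^ 4))" using C by simp
  also have "\<dots> \<le> real M * real s0" using M s0 by (intro mult_mono) auto
  finally have nM: "n \<le> M * s0" by (simp flip: of_nat_mult)
  have r: "real r \<le> 50 * L" unfolding r_def degree_bound_def L_def[symmetric] using L by linarith
  \<comment> \<open>With \<open>r \<le> 50 * C\<close> and \<open>M \<le> 9 * C^4\<close> the
    argument is at most \<open>22500 * C^6 + 2 \<le> 2^15 * C^6\<close>, and
    \<open>2 \<le> C\<close> turns the numerical factor into \<open>C^15\<close>, so that the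
    logarithm is a pure multiple of \<open>ln C\<close> even for small \<open>C\<close>.\<close>
  have ln_colours: "ln (real (M * r\<^sup>2 + 2)) \<le> 21 * L"
  proof -
    have "real (M * r\<^sup>2 + 2) = real M * (real r)\<^sup>2 + 2" by simp
    also have "real M * (real r)\<^sup>2 \<le> (9 * C ^ 4) * (50 * C)\<^sup>2"
      using M r L by (intro mult_mono power_mono) auto
    also have "(9 * C ^ 4) * (50 * C)\<^sup>2 = 22500 * C ^ 6"
      by (simp add: power_mult_distrib flip: power_add)
    also have "22500 * C ^ 6 + 2 \<le> 2 ^ 15 * C ^ 6"
    proof -
      have "1 \<le> C ^ 6" using C by simp
      then show ?thesis by simp
    qed
    finally have "real (M * r\<^sup>2 + 2) \<le> 2 ^ 15 * C ^ 6" by simp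
    also have "2 ^ 15 * C ^ 6 \<le> C ^ 15 * C ^ 6" using C by (intro mult_right_mono power_mono) auto
    also have "\<dots> = C ^ 21" by (simp flip: power_add)
    finally have le: "real (M * r\<^sup>2 + 2) \<le> C ^ 21" .
    have "ln (real (M * r\<^sup>2 + 2)) \<le> ln (C ^ 21)" by (intro ln_mono le) (simp only: of_nat_0_less_iff add_gr_0, simp)
    then show ?thesis using C by (simp add: ln_realpow L_def)
  qed
  have "coverable E (left_part n \<times> right_part n - E) (q * (2 * t) + 1156)"
  proof (rule coverable_sparse[where M = M and ?s0.0 = s0 and r = r and Y = "block C n"])
    show "2 \<le> M" using M C1 by linarith
    show "card (left_part n) \<le> M * s0" using nM by simp
    show "right_part n = (\<Union>i<q. block C n i)" unfolding q_def by (rule UN_block)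
    show "card {a\<in>left_part n. \<exists>i<q. r < card {b\<in>block C n i. (a, b) \<in> E}} \<le> s0"
      using exceptional by (simp add: q_def r_def s0_def)
    show "3 * real (r + 1) ^ 2 * ln (real (M * r\<^sup>2 + 2)) < real t" unfolding t_def by linarith
  next
    fix S assume S: "S \<subseteq> right_part n" "S \<noteq> {}" "card S \<le> s0"
    have "\<not> 2 * card S \<le> card {a\<in>left_part n. 2 \<le> card {b\<in>S. (a, b) \<in> E}}"
      "\<not> 1 * card S \<le> card {a\<in>left_part n. 3 \<le> card {b\<in>S. (a, b) \<in> E}}"
      using left S unfolding crowded_def s0_def[symmetric] by blast+
    then show "card {a\<in>left_part n. 2 \<le> card {b\<in>S. (a, b) \<in> E}} \<le> 2 * card S"
      and "card {a\<in>left_part n. 3 \<le> card {b\<in>S. (a, b) \<in> E}} < card S" by linarith+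
  next
    fix S assume S: "S \<subseteq> left_part n" "S \<noteq> {}" "card S \<le> s0"
    have "\<not> 2 * card S \<le> card {b\<in>right_part n. 2 \<le> card {a\<in>S. (b, a) \<in> E\<inverse>}}"
      "\<not> 1 * card S \<le> card {b\<in>right_part n. 3 \<le> card {a\<in>S. (b, a) \<in> E\<inverse>}}"
      using right S unfolding crowded_def s0_def[symmetric] by blast+
    then show "card {b\<in>right_part n. 2 \<le> card {a\<in>S. (a, b) \<in> E}} \<le> 2 * card S"
      and "card {b\<in>right_part n. 3 \<le> card {a\<in>S. (a, b) \<in> E}} < card S"
      unfolding converse_iff by linarith+
  qed auto
  then have dim: "bipartite_dim n E \<le> q * (2 * t) + 1156 + 2" by (rule bipartite_dim_le[OF E])
  have q: "real q \<le> 2 * C / L" unfolding q_def L_def by (rule blocks_le[OF C(1) n])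
  \<comment> \<open>Here \<open>170368 = 3 * 52^2 * 21 + 16\<close>:
    \<open>r + 1 \<le> 52 * L\<close>, the logarithm is at most \<open>21 * L\<close>, and the
    rounding term 2 is at most \<open>16 * L^3\<close> because \<open>L \<ge> 1 / 2\<close>.\<close>
  have t: "2 * real t \<le> 2 * (170368 * L ^ 3)"
  proof -
    define w where "w = 3 * real (r + 1) ^ 2 * ln (real (M * r\<^sup>2 + 2))"
    have "0 \<le> ln (real (M * r\<^sup>2 + 2))" by (rule ln_ge_zero) simp
    then have "0 \<le> w" unfolding w_def by (intro mult_nonneg_nonneg) auto
    then have "real t \<le> w + 2" unfolding t_def w_def[symmetric] by linarith
    moreover have "w \<le> 3 * (52 * L) ^ 2 * (21 * L)"
      unfolding w_def using r L by (intro mult_mono power_mono ln_colours) auto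
    ultimately have "real t \<le> 3 * (52 * L) ^ 2 * (21 * L) + 2" by linarith
    moreover have "1 \<le> 8 * L ^ 3" using power_mono[of "1 / 2" L 3] L by (simp add: power3_eq_cube)
    ultimately show ?thesis by (simp add: power2_eq_square power3_eq_cube)
  qed
  \<comment> \<open>The additive cost of the exceptional vertices and of the two extra orders is
    absorbed, since \<open>C * L^2 \<ge> 1 / 2\<close>.\<close>
  have const: "1158 \<le> 2316 * (C * L\<^sup>2)"
  proof -
    have "2 * (1 / 2)\<^sup>2 \<le> C * L\<^sup>2" using C L by (intro mult_mono power_mono) auto
    then show ?thesis by (simp add: power2_eq_square)
  qed
  have "real (bipartite_dim n E) \<le> real (q * (2 * t) + 1156 + 2)" using dim by (rule of_nat_mono)
  also have "\<dots> = real q * (2 * real t) + 1158" by simp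
  also have "\<dots> \<le> (2 * C / L) * (2 * (170368 * L ^ 3)) + 2316 * (C * L\<^sup>2)"
    by (rule add_mono[OF mult_mono[OF q t] const]) (use C L in auto)
  also have "(2 * C / L) * (2 * (170368 * L ^ 3)) = 681472 * (C * L\<^sup>2)"
    using L by (simp add: power2_eq_square power3_eq_cube)
  also have "681472 * (C * L\<^sup>2) + 2316 * (C * L\<^sup>2) \<le> 700000 * (C * L\<^sup>2)"
  proof -
    have "0 \<le> C * L\<^sup>2" using C by simp
    then show ?thesis by linarith
  qed
  finally show ?thesis by (simp add: L_def mult_ac)
qed

lemma aas_dim_le:
  assumes c: "admissible c"
  shows "aas (\<lambda>n. random_bipartite n (c n / real n))
    (\<lambda>n E. real (bipartite_dim n E) \<le> 700000 * c n * (ln (c n))\<^sup>2)"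
proof -
  have 2: "2 = (2::nat) \<and> 2 = (2::nat) \<or> 2 = (3::nat) \<and> 2 = (1::nat)"
    and 3: "3 = (2::nat) \<and> 1 = (2::nat) \<or> 3 = (3::nat) \<and> 1 = (1::nat)" by auto
  note all = aas_conj[OF aas_conj[OF aas_not_crowded(1)[OF c 2] aas_not_crowded(1)[OF c 3]]
      aas_conj[OF aas_conj[OF aas_not_crowded(2)[OF c 2] aas_not_crowded(2)[OF c 3]] aas_exceptional[OF c]]]
  show ?thesis
  proof (rule aas_mono[OF all])
    show "\<forall>\<^sub>F n in sequentially. \<forall>E\<in>set_pmf (random_bipartite n (c n / real n)).
      (\<not> crowded E (left_part n) (right_part n) 2 2 (crowd_size (c n) n) \<and>
       \<not> crowded E (left_part n) (right_part n) 3 1 (crowd_size (c n) n)) \<and>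
      (\<not> crowded (E\<inverse>) (right_part n) (left_part n) 2 2 (crowd_size (c n) n) \<and>
       \<not> crowded (E\<inverse>) (right_part n) (left_part n) 3 1 (crowd_size (c n) n)) \<and>
      card {a\<in>left_part n. \<exists>i<blocks (c n) n. degree_bound (c n) < card {b\<in>block (c n) n i. (a, b) \<in> E}}
        \<le> crowd_size (c n) n \<longrightarrow>
      real (bipartite_dim n E) \<le> 700000 * c n * (ln (c n))\<^sup>2"
      using admissible_eventually[OF c]
    proof eventually_elim
      case (elim n)
      then show ?case using dim_le_if_sparse[of "c n" n] random_bipartite_subset by blast
    qed
  qed
qed

theorem theorem1p10:
  shows "(\<forall>c. admissible c \<longrightarrow>
            (\<exists>\<epsilon>::nat \<Rightarrow> real. \<epsilon> \<longlonglongrightarrow> 0 \<and>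
               aas (\<lambda>n. random_bipartite n (c n / real n))
                 (\<lambda>n E. real (bipartite_dim n E) \<ge> (1 - \<epsilon> n) * (1 / (2 * alpha (c n))))))
       \<and> (\<exists>\<gamma>1 \<gamma>2::real. \<gamma>1 > 0 \<and> \<gamma>2 > 0 \<and>
            (\<forall>c. admissible c \<longrightarrow>
               aas (\<lambda>n. random_bipartite n (c n / real n))
                 (\<lambda>n E. \<gamma>1 * c n / ln (c n) \<le> real (bipartite_dim n E)
                       \<and> real (bipartite_dim n E) \<le> \<gamma>2 * c n * (ln (c n)) ^ 2)))"
proof (intro conjI allI impI)
  show "\<exists>\<epsilon>::nat \<Rightarrow> real. \<epsilon> \<longlonglongrightarrow> 0 \<and> aas (\<lambda>n. random_bipartite n (c n / real n))
      (\<lambda>n E. real (bipartite_dim n E) \<ge> (1 - \<epsilon> n) * (1 / (2 * alpha (c n))))"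
    if "admissible c" for c
    using dim_error_tendsto_0[OF that] aas_dim_ge[OF that] by blast
  show "\<exists>\<gamma>1 \<gamma>2::real. \<gamma>1 > 0 \<and> \<gamma>2 > 0 \<and>
      (\<forall>c. admissible c \<longrightarrow> aas (\<lambda>n. random_bipartite n (c n / real n))
        (\<lambda>n E. \<gamma>1 * c n / ln (c n) \<le> real (bipartite_dim n E)
             \<and> real (bipartite_dim n E) \<le> \<gamma>2 * c n * (ln (c n)) ^ 2))"
    by (intro exI[of _ "1 / 16"] exI[of _ 700000] conjI allI impI aas_conj aas_dim_ge_log aas_dim_le) auto
qed

end
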